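(* Let $S$ be a domain in $\mathbb{R}^2$, let $a\neq 0$, and let $u,v\in C^2(S)$ satisfy $$\frac{\partial u}{\partial x}=\frac{\partial v}{\partial y}\quad\text{and}\quad \frac{\partial v}{\partial x}=-2\bigl(v^2+y^2+a^2\bigr)^{1/2}\frac{\partial u}{\partial y}. \qquad ( * )$$ Then $$\frac{\partial}{\partial x}\Bigl[\bigl(v^2+y^2+a^2\bigr)^{-1/2}\frac{\partial v}{\partial x}\Bigr]+2\,\frac{\partial^2 v}{\partial y^2}=0. \qquad ( ** )$$ Conversely, if $v\in C^2(S)$ satisfies $( ** )$ then there exists $u\in C^2(S)$, unique up to addition of a constant $u\mapsto u+c$, such that $u,v$ satisfy $( * )$.
   Context: A domain in $\mathbb{R}^2$ is a closed, bounded, contractible subset $S\subset\mathbb{R}^2$ which is a disjoint union $S=S^\circ\cup\partial S$, where the interior $S^\circ$ is a connected open set with $S=\overline{S^\circ}$, and $\partial S=S\setminus S^\circ$ is a compact embedded hypersurface (smooth embedded curve). $C^k(S)$ is the space of continuous functions on $S$ with $k$ continuous derivatives on $S$ (up to the boundary). *)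

theory Defs
  imports "HOL-Analysis.Analysis"
begin

definition smooth_path_on :: "real set \<Rightarrow> (real \<Rightarrow> real \<times> real) \<Rightarrow> bool" where
  "smooth_path_on I \<gamma> \<longleftrightarrow>
     (\<forall>n. ((\<lambda>g t. vector_derivative g (at t)) ^^ n) \<gamma> differentiable_on I)"

text \<open>A smooth embedded curve without boundary: a one-dimensional embedded submanifold of the
  plane, described by regular local parametrisations that are homeomorphisms onto relatively
  open pieces of the curve. It need not be connected.\<close>

definition smooth_embedded_curve :: "(real \<times> real) set \<Rightarrow> bool" where
  "smooth_embedded_curve C \<longleftrightarrow>
     (\<forall>p\<in>C. \<exists>U \<gamma> \<gamma>'. open U \<and> p \<in> U \<and>
        smooth_path_on {-1<..<1} \<gamma> \<and>
        (\<forall>t\<in>{-1<..<1}. vector_derivative \<gamma> (at t) \<noteq> 0) \<and>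
        homeomorphism {-1<..<1} (C \<inter> U) \<gamma> \<gamma>')"

text \<open>The library's \<^const>\<open>contractible\<close> holds of the empty set, so nonemptiness is
  required separately.\<close>

definition planar_domain :: "(real \<times> real) set \<Rightarrow> bool" where
  "planar_domain S \<longleftrightarrow>
     closed S \<and> bounded S \<and> S \<noteq> {} \<and> contractible S \<and>
     connected (interior S) \<and> S = closure (interior S) \<and>
     compact (S - interior S) \<and> smooth_embedded_curve (S - interior S)"

text \<open>Partial derivatives of a function on \<open>S\<close>, also at boundary points: the components of the
  derivative relative to \<open>S\<close>. For a differentiable function on a planar domain this derivative is
  unique at every point of \<open>S\<close>, because \<open>S\<close> lies locally on one side of its smooth boundary.
  Values of the function outside \<open>S\<close> are irrelevant.\<close>

definition pdx :: "(real \<times> real) set \<Rightarrow> (real \<times> real \<Rightarrow> real) \<Rightarrow> real \<times> real \<Rightarrow> real" where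
  "pdx S f p = frechet_derivative f (at p within S) (1, 0)"

definition pdy :: "(real \<times> real) set \<Rightarrow> (real \<times> real \<Rightarrow> real) \<Rightarrow> real \<times> real \<Rightarrow> real" where
  "pdy S f p = frechet_derivative f (at p within S) (0, 1)"

primrec Ck_on :: "nat \<Rightarrow> (real \<times> real) set \<Rightarrow> (real \<times> real \<Rightarrow> real) \<Rightarrow> bool" where
  "Ck_on 0 S f \<longleftrightarrow> continuous_on S f"
| "Ck_on (Suc k) S f \<longleftrightarrow> f differentiable_on S \<and> Ck_on k S (pdx S f) \<and> Ck_on k S (pdy S f)"

definition first_order_system ::
  "(real \<times> real) set \<Rightarrow> real \<Rightarrow> (real \<times> real \<Rightarrow> real) \<Rightarrow> (real \<times> real \<Rightarrow> real) \<Rightarrow> bool" where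
  "first_order_system S a u v \<longleftrightarrow>
     (\<forall>(x, y)\<in>S.
        pdx S u (x, y) = pdy S v (x, y) \<and>
        pdx S v (x, y) = - 2 * ((v (x, y))\<^sup>2 + y\<^sup>2 + a\<^sup>2) powr (1/2) * pdy S u (x, y))"

definition second_order_equation ::
  "(real \<times> real) set \<Rightarrow> real \<Rightarrow> (real \<times> real \<Rightarrow> real) \<Rightarrow> bool" where
  "second_order_equation S a v \<longleftrightarrow>
     (\<forall>(x, y)\<in>S.
        pdx S (\<lambda>(x, y). ((v (x, y))\<^sup>2 + y\<^sup>2 + a\<^sup>2) powr (- 1/2) * pdx S v (x, y)) (x, y)
          + 2 * pdy S (pdy S v) (x, y) = 0)"

end

theory Submission
  imports Defs "HOL-Complex_Analysis.Riemann_Mapping"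
begin

text \<open>
  In terms of the flux \<open>q = (v\<^sup>2 + y\<^sup>2 + a\<^sup>2) powr (- 1/2) * v\<^sub>x\<close>, the first order system reads
  \<open>u\<^sub>x = v\<^sub>y\<close>, \<open>u\<^sub>y = - q / 2\<close>, and the second order equation reads \<open>q\<^sub>x + 2 v\<^sub>y\<^sub>y = 0\<close>. So the system says
  that \<open>u\<close> is a primitive of the 1-form \<open>v\<^sub>y dx - (q / 2) dy\<close>, and the equation says that this form is
  closed. The first half of the theorem is therefore the symmetry of the mixed second derivatives of
  \<open>u\<close> (\<open>planar_domain_mixed_partials\<close>), and the second half is the Poincare lemma on \<open>S\<close>
  (\<open>planar_domain_closed_form_exact\<close>) together with the fact that functions with equal derivatives
  differ by a constant (\<open>planar_domain_differ_by_constant\<close>). The work lies in the boundary and in the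
  topology of \<open>S\<close>.

  Boundary: all derivatives are taken relative to \<open>S\<close>, and it has to be shown that they are unique
  at boundary points and that a primitive on the interior extends to \<open>S\<close> with the expected
  derivatives. Both follow from a chart (\<open>boundary_chart\<close>) that maps a half ball onto the
  part of the interior of \<open>S\<close> near the boundary point and that is close to a similarity.
  Since it is bi-Lipschitz with fixed constants, the mean value theorem on the convex half ball
  controls the increments of a function near the boundary (\<open>planar_domain_increment_bound\<close>), even
  though \<open>S\<close> itself need not be convex there.

  Topology: a contractible compact set does not separate the plane, and this makes the interior of \<open>S\<close>
  simply connected (\<open>planar_domain_interior_simply_connected\<close>). A Riemann map then transports closed
  1-forms to the disc, where the radial integral is a primitive (\<open>Poincare_lemma_ball\<close>).
\<close>

section \<open>Straightening the boundary\<close>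

text \<open>With \<open>\<tau>\<close> the tangent vector of the curve at \<open>p\<close> and \<open>n\<close> its rotation by a right angle, the chart is
  \<open>\<Phi> (x, y) = \<gamma> (t0 + x) + y n\<close>. Its derivative at \<open>0\<close> is the similarity \<open>A (x, y) = x \<tau> + y n\<close>, which
  stretches every vector by \<open>m = norm \<tau>\<close>, and by continuity of the tangent the derivative of
  \<open>\<Phi> - A\<close> stays below \<open>m / 2\<close> nearby. Hence \<open>\<Phi>\<close> is injective and bi-Lipschitz with constants
  \<open>m / 2\<close> and \<open>3 / 2 * m\<close>, whatever the radius: this scale invariance is what makes the later
  estimates at boundary points work. A point of the curve near \<open>p\<close> is \<open>\<gamma> t\<close> with \<open>t\<close> near \<open>t0\<close>,
  because \<open>\<gamma>\<close> is a homeomorphism onto its image; so it is also \<open>\<Phi> (t - t0, 0)\<close>, and injectivity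
  excludes other preimages.\<close>

lemma curve_chart:
  assumes C: "smooth_embedded_curve C" and "p \<in> C"
  obtains \<Phi> A :: "real \<times> real \<Rightarrow> real \<times> real" and m r
  where "0 < m" "0 < r" "linear A" "\<And>z. norm (A z) = m * norm z"
    "\<Phi> 0 = p" "(\<Phi> has_derivative A) (at 0)"
    "\<And>z. z \<in> ball 0 r \<Longrightarrow> \<exists>P. (\<Phi> has_derivative P) (at z) \<and> (\<forall>h. norm (P h) \<le> 3 / 2 * m * norm h)"
    "\<And>z w. z \<in> ball 0 r \<Longrightarrow> w \<in> ball 0 r \<Longrightarrow> norm (\<Phi> z - \<Phi> w - A (z - w)) \<le> m / 2 * norm (z - w)"
    "\<And>z. z \<in> ball 0 r \<Longrightarrow> \<Phi> z \<in> C \<longleftrightarrow> snd z = 0"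
proof -
  obtain U \<gamma> \<gamma>' where U: "open U" "p \<in> U" and smooth: "smooth_path_on {-1<..<1} \<gamma>"
    and regular: "\<forall>t\<in>{-1<..<1}. vector_derivative \<gamma> (at t) \<noteq> 0"
    and hom: "homeomorphism {-1<..<1} (C \<inter> U) \<gamma> \<gamma>'"
    using assms unfolding smooth_embedded_curve_def by metis
  define d where "d t = vector_derivative \<gamma> (at t)" for t
  define t0 where "t0 = \<gamma>' p"
  have t0: "t0 \<in> {-1<..<1}" "\<gamma> t0 = p"
    using hom \<open>p \<in> C\<close> U unfolding homeomorphism_def t0_def by auto
  have d: "(\<gamma> has_vector_derivative d t) (at t)" if "t \<in> {-1<..<1}" for t
  proof -
    have "\<gamma> differentiable_on {-1<..<1}"
      using smooth unfolding smooth_path_on_def by (metis funpow_0)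
    then have "\<gamma> differentiable at t"
      using that by (meson differentiable_on_eq_differentiable_at open_greaterThanLessThan)
    then show ?thesis
      unfolding d_def by (simp add: vector_derivative_works)
  qed
  have "d differentiable_on {-1<..<1}"
    using smooth[unfolded smooth_path_on_def, rule_format, of 1] by (simp add: d_def[abs_def])
  then have d_cont: "continuous_on {-1<..<1} d"
    by (rule differentiable_imp_continuous_on)
  define \<tau> where "\<tau> = d t0"
  define m where "m = norm \<tau>"
  define n where "n = (- snd \<tau>, fst \<tau>)"
  have m: "0 < m" using regular t0 by (simp add: m_def \<tau>_def d_def)
  define A where "A z = fst z *\<^sub>R \<tau> + snd z *\<^sub>R n" for z :: "real \<times> real"
  define \<Phi> where "\<Phi> z = \<gamma> (t0 + fst z) + snd z *\<^sub>R n" for z :: "real \<times> real"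
  have linA: "linear A"
    by (rule linearI) (auto simp: A_def algebra_simps)
  have normA: "norm (A z) = m * norm z" for z
  proof -
    have "(norm (A z))\<^sup>2 = (m * norm z)\<^sup>2"
      by (simp add: A_def m_def n_def norm_Pair norm_prod_def power_mult_distrib)
         (simp add: power2_eq_square algebra_simps)
    then show ?thesis using m by (simp add: power2_eq_iff_nonneg)
  qed
  obtain \<delta> where \<delta>: "\<delta> > 0" "\<And>t. \<bar>t - t0\<bar> < \<delta> \<Longrightarrow> t \<in> {-1<..<1}"
    "\<And>t. \<bar>t - t0\<bar> < \<delta> \<Longrightarrow> norm (d t - \<tau>) \<le> m / 2"
  proof -
    obtain \<delta>1 where \<delta>1: "\<delta>1 > 0" "\<And>t. t\<in>{-1<..<1} \<Longrightarrow> dist t t0 < \<delta>1 \<Longrightarrow> dist (d t) \<tau> < m/2"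
      using d_cont t0 m unfolding continuous_on_iff \<tau>_def by (metis half_gt_zero)
    show thesis
      by (rule that[of "min \<delta>1 (min (1 - t0) (1 + t0))"])
         (use t0 \<delta>1 in \<open>auto simp: dist_norm abs_less_iff intro!: less_imp_le\<close>)
  qed
  have \<Phi>_deriv: "(\<Phi> has_derivative (\<lambda>h. fst h *\<^sub>R d (t0 + fst z) + snd h *\<^sub>R n)) (at z)"
    if "z \<in> ball 0 \<delta>" for z
  proof -
    have "\<bar>fst z\<bar> < \<delta>" using that norm_fst_le[of "fst z" "snd z"] by auto
    then have "(\<gamma> has_derivative (\<lambda>h. h *\<^sub>R d (t0 + fst z))) (at (t0 + fst z))"
      using d \<delta>(2) unfolding has_vector_derivative_def by simp
    moreover have "((\<lambda>z. t0 + fst z) has_derivative fst) (at z)"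
      by (auto intro!: derivative_eq_intros)
    ultimately have "((\<lambda>z. \<gamma> (t0 + fst z)) has_derivative (\<lambda>h. fst h *\<^sub>R d (t0 + fst z))) (at z)"
      using has_derivative_compose[of "\<lambda>z. t0 + fst z" fst z UNIV \<gamma>] by simp
    then show ?thesis
      unfolding \<Phi>_def by (auto intro!: derivative_eq_intros)
  qed
  have d_near: "norm (fst h *\<^sub>R d (t0 + fst x) + snd h *\<^sub>R n - A h) \<le> m / 2 * norm h"
    if x: "x \<in> ball 0 \<delta>" for x h :: "real \<times> real"
  proof -
    have "\<bar>fst x\<bar> < \<delta>" using x norm_fst_le[of "fst x" "snd x"] by auto
    then have *: "norm (d (t0 + fst x) - \<tau>) \<le> m / 2" using \<delta>(3) by simp
    have "norm (fst h *\<^sub>R d (t0 + fst x) + snd h *\<^sub>R n - A h)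
        = \<bar>fst h\<bar> * norm (d (t0 + fst x) - \<tau>)"
      by (simp add: A_def scaleR_diff_right flip: norm_scaleR)
    also have "\<dots> \<le> norm h * (m/2)"
      using norm_fst_le[of "fst h" "snd h"] * by (intro mult_mono) auto
    finally show ?thesis by (simp add: mult.commute)
  qed
  have near: "norm (\<Phi> z - \<Phi> w - A (z - w)) \<le> m / 2 * norm (z - w)"
    if "z \<in> ball 0 \<delta>" "w \<in> ball 0 \<delta>" for z w
  proof -
    have "norm ((\<Phi> z - A z) - (\<Phi> w - A w)) \<le> m/2 * norm (z - w)"
    proof (rule differentiable_bound[OF convex_ball])
      fix x assume x: "x \<in> ball (0::real\<times>real) \<delta>"
      show "((\<lambda>z. \<Phi> z - A z) has_derivative
          (\<lambda>h. fst h *\<^sub>R d (t0 + fst x) + snd h *\<^sub>R n - A h)) (at x within ball 0 \<delta>)"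
        using linA by (intro has_derivative_diff has_derivative_at_withinI[OF \<Phi>_deriv[OF x]]
            linear_imp_has_derivative)
      show "onorm (\<lambda>h. fst h *\<^sub>R d (t0 + fst x) + snd h *\<^sub>R n - A h) \<le> m/2"
        by (rule onorm_le) (rule d_near[OF x])
    qed (use that in auto)
    moreover have "\<Phi> z - \<Phi> w - A (z - w) = (\<Phi> z - A z) - (\<Phi> w - A w)"
      by (simp add: linear_diff[OF linA])
    ultimately show ?thesis by (simp only:)
  qed
  have \<Phi>0: "\<Phi> 0 = p" using t0 by (simp add: \<Phi>_def)
  obtain \<rho> where \<rho>: "\<rho> > 0" "ball p \<rho> \<subseteq> U" "\<And>q. q \<in> C \<inter> ball p \<rho> \<Longrightarrow> \<bar>\<gamma>' q - t0\<bar> < \<delta>"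
  proof -
    obtain \<rho>1 where \<rho>1: "\<rho>1 > 0" "ball p \<rho>1 \<subseteq> U" using U open_contains_ball by metis
    have "continuous_on (C \<inter> U) \<gamma>'" using hom by (simp add: homeomorphism_def)
    then obtain \<rho>2 where \<rho>2: "\<rho>2 > 0" "\<And>q. q \<in> C \<inter> U \<Longrightarrow> dist q p < \<rho>2 \<Longrightarrow> dist (\<gamma>' q) t0 < \<delta>"
      using \<open>p \<in> C\<close> U \<delta>(1) unfolding continuous_on_iff t0_def by (metis IntI)
    show thesis
      by (rule that[of "min \<rho>1 \<rho>2"]) (use \<rho>1 \<rho>2 in \<open>auto simp: dist_norm norm_minus_commute subset_iff\<close>)
  qed
  \<comment> \<open>The radius makes \<open>\<Phi>\<close>, which is Lipschitz with constant \<open>3 / 2 * m\<close>, map into \<open>ball p \<rho>\<close>.\<close>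
  define r where "r = min \<delta> (\<rho> / (3/2 * m))"
  have r: "0 < r" "r \<le> \<delta>" "3/2 * m * r \<le> \<rho>"
    using \<delta>(1) \<rho>(1) m by (auto simp: r_def min_def field_simps)
  have \<Phi>_ball: "\<Phi> z \<in> ball p \<rho>" if "z \<in> ball 0 r" for z
  proof -
    have "norm (\<Phi> z - \<Phi> 0 - A (z - 0)) \<le> m / 2 * norm (z - 0)"
      using that r \<delta>(1) by (intro near) auto
    then have "norm (\<Phi> z - p) \<le> m / 2 * norm z + norm (A z)"
      using norm_triangle_ineq[of "\<Phi> z - p - A z" "A z"] by (simp add: \<Phi>0)
    also have "\<dots> = 3/2 * m * norm z" by (simp add: normA)
    also have "\<dots> < 3/2 * m * r" using that m by simp
    finally show ?thesis using r by (simp add: dist_norm norm_minus_commute)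
  qed
  have curve: "\<Phi> z \<in> C \<longleftrightarrow> snd z = 0" if z: "z \<in> ball 0 r" for z
  proof
    assume "snd z = 0"
    moreover have "\<bar>fst z\<bar> < \<delta>" using z r norm_fst_le[of "fst z" "snd z"] by auto
    then have "t0 + fst z \<in> {-1<..<1}" by (intro \<delta>(2)) simp
    ultimately show "\<Phi> z \<in> C"
      using hom unfolding homeomorphism_def \<Phi>_def by auto
  next
    assume zC: "\<Phi> z \<in> C"
    define w where "w = (\<gamma>' (\<Phi> z) - t0, 0::real)"
    have "\<Phi> z \<in> C \<inter> U" using zC \<Phi>_ball[OF z] \<rho>(2) by auto
    then have "\<gamma> (\<gamma>' (\<Phi> z)) = \<Phi> z" using hom by (simp add: homeomorphism_def)
    then have eq: "\<Phi> w = \<Phi> z" by (simp add: \<Phi>_def w_def)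
    have "w \<in> ball 0 \<delta>"
      using \<rho>(3)[of "\<Phi> z"] zC \<Phi>_ball[OF z] by (simp add: w_def norm_Pair)
    then have "norm (\<Phi> w - \<Phi> z - A (w - z)) \<le> m / 2 * norm (w - z)"
      using z r by (intro near) auto
    then have "m * norm (w - z) \<le> m / 2 * norm (w - z)" by (simp add: eq normA)
    then have "w = z" using m by (simp add: field_simps)
    then show "snd z = 0" by (metis snd_conv w_def)
  qed
  show thesis
  proof (rule that[OF m r(1) linA normA \<Phi>0 _ _ near curve])
    show "(\<Phi> has_derivative A) (at 0)"
      using \<Phi>_deriv[of 0] \<delta>(1) by (simp add: A_def[abs_def] \<tau>_def)
    fix z :: "real \<times> real" assume "z \<in> ball 0 r"
    then have z: "z \<in> ball 0 \<delta>" using r by simp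
    have "norm (fst h *\<^sub>R d (t0 + fst z) + snd h *\<^sub>R n) \<le> 3 / 2 * m * norm h" for h
    proof -
      have "norm (fst h *\<^sub>R d (t0 + fst z) + snd h *\<^sub>R n)
          \<le> norm (fst h *\<^sub>R d (t0 + fst z) + snd h *\<^sub>R n - A h) + norm (A h)"
        using norm_triangle_sub[of "fst h *\<^sub>R d (t0 + fst z) + snd h *\<^sub>R n" "A h"] by simp
      then show ?thesis using d_near[OF z, of h] by (simp add: normA)
    qed
    then show "\<exists>P. (\<Phi> has_derivative P) (at z) \<and> (\<forall>h. norm (P h) \<le> 3 / 2 * m * norm h)"
      using \<Phi>_deriv[OF z] by blast
  qed (use r in auto)
qed

lemma convex_upper_half_plane: "convex {z :: real \<times> real. 0 < snd z}"
  and convex_lower_half_plane: "convex {z :: real \<times> real. snd z < 0}"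
  using convex_halfspace_gt[of 0 "(0, 1) :: real \<times> real"]
    convex_halfspace_lt[of "(0, 1) :: real \<times> real" 0] by (simp_all add: inner_prod_def)

text \<open>The two open half balls are mapped to connected sets that avoid the boundary, so each of them
  lies entirely in the interior of \<open>S\<close> or entirely outside \<open>S\<close>. They cannot both lie inside, since then
  \<open>p\<close> would be an interior point (the image of the ball is open by invariance of domain), nor both
  outside, since \<open>p\<close> is a limit of interior points. Precomposing with \<open>z \<mapsto> - z\<close>, if necessary, makes the
  upper half the inner one.\<close>

lemma boundary_chart:
  assumes S: "planar_domain S" and p: "p \<in> S - interior S"
  obtains \<Phi> A :: "real \<times> real \<Rightarrow> real \<times> real" and m r
  where "0 < m" "0 < r" "linear A" "\<And>z. norm (A z) = m * norm z"
    "\<Phi> 0 = p" "(\<Phi> has_derivative A) (at 0)"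
    "\<And>z. z \<in> ball 0 r \<Longrightarrow> \<exists>P. (\<Phi> has_derivative P) (at z) \<and> (\<forall>h. norm (P h) \<le> 3 / 2 * m * norm h)"
    "\<And>z w. z \<in> ball 0 r \<Longrightarrow> w \<in> ball 0 r \<Longrightarrow> norm (\<Phi> z - \<Phi> w - A (z - w)) \<le> m / 2 * norm (z - w)"
    "\<And>\<rho>. \<rho> \<le> r \<Longrightarrow> open (\<Phi> ` ball 0 \<rho>)"
    "\<And>z. z \<in> ball 0 r \<Longrightarrow> \<Phi> z \<in> interior S \<longleftrightarrow> 0 < snd z"
    "\<And>z. z \<in> ball 0 r \<Longrightarrow> \<Phi> z \<in> S \<longleftrightarrow> 0 \<le> snd z"
proof -
  have clo: "S = closure (interior S)" and closed: "closed S"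
    using S by (auto simp: planar_domain_def)
  have emb: "smooth_embedded_curve (S - interior S)"
    using S by (simp add: planar_domain_def)
  obtain \<Phi> A :: "real \<times> real \<Rightarrow> real \<times> real" and m r
    where m: "0 < m" and r: "0 < r" and A: "linear A" "\<And>z. norm (A z) = m * norm z"
    and \<Phi>0: "\<Phi> 0 = p" "(\<Phi> has_derivative A) (at 0)"
    and diff: "\<And>z. z \<in> ball 0 r \<Longrightarrow> \<exists>P. (\<Phi> has_derivative P) (at z) \<and> (\<forall>h. norm (P h) \<le> 3 / 2 * m * norm h)"
    and near: "\<And>z w. z \<in> ball 0 r \<Longrightarrow> w \<in> ball 0 r \<Longrightarrow> norm (\<Phi> z - \<Phi> w - A (z - w)) \<le> m / 2 * norm (z - w)"
    and curve: "\<And>z. z \<in> ball 0 r \<Longrightarrow> \<Phi> z \<in> S - interior S \<longleftrightarrow> snd z = 0"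
    by (rule curve_chart[OF emb p]) (rule that; assumption)
  have cont: "continuous_on (ball 0 r) \<Phi>"
  proof (intro continuous_at_imp_continuous_on ballI)
    fix z assume "z \<in> ball (0 :: real \<times> real) r"
    then obtain P where "(\<Phi> has_derivative P) (at z)" using diff by blast
    then show "isCont \<Phi> z" by (rule has_derivative_continuous)
  qed
  have inj: "inj_on \<Phi> (ball 0 r)"
  proof (rule inj_onI)
    fix z w assume "z \<in> ball 0 r" "w \<in> ball 0 r" "\<Phi> z = \<Phi> w"
    with near[of z w] have "m * norm (z - w) \<le> m / 2 * norm (z - w)" by (simp add: A)
    then show "z = w" using m by (simp add: field_simps)
  qed
  have opn: "open (\<Phi> ` ball 0 \<rho>)" if "\<rho> \<le> r" for \<rho>
    using that by (intro invariance_of_domain continuous_on_subset[OF cont] inj_on_subset[OF inj]) auto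
  let ?U = "ball 0 r \<inter> {z :: real \<times> real. 0 < snd z}"
  let ?L = "ball 0 r \<inter> {z :: real \<times> real. snd z < 0}"
  have cvx: "convex ?U" "convex ?L"
    by (intro convex_Int convex_ball convex_upper_half_plane convex_lower_half_plane)+
  have one_side: "\<Phi> ` W \<subseteq> interior S \<or> \<Phi> ` W \<inter> S = {}"
    if "convex W" "W \<subseteq> ball 0 r" "\<And>z. z \<in> W \<Longrightarrow> snd z \<noteq> 0" for W
  proof -
    have "connected (\<Phi> ` W)"
      using that by (intro connected_continuous_image continuous_on_subset[OF cont] convex_connected)
    moreover have "\<Phi> ` W \<subseteq> interior S \<union> - S" using curve that by blast
    moreover have "interior S \<inter> (- S) \<inter> \<Phi> ` W = {}" using interior_subset by blast
    ultimately have "interior S \<inter> \<Phi> ` W = {} \<or> - S \<inter> \<Phi> ` W = {}"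
      using closed by (intro connectedD) auto
    then show ?thesis using \<open>\<Phi> ` W \<subseteq> interior S \<union> - S\<close> interior_subset by blast
  qed
  have not_both_in: "\<not> (\<Phi> ` ?U \<subseteq> interior S \<and> \<Phi> ` ?L \<subseteq> interior S)"
  proof
    assume both: "\<Phi> ` ?U \<subseteq> interior S \<and> \<Phi> ` ?L \<subseteq> interior S"
    have "\<Phi> ` ball 0 r \<subseteq> S"
    proof (rule image_subsetI)
      fix z assume z: "z \<in> ball (0::real\<times>real) r"
      consider "z \<in> ?U" | "z \<in> ?L" | "snd z = 0" using z by force
      then show "\<Phi> z \<in> S"
      proof cases
        case 3 then show ?thesis using curve[OF z] by auto
      qed (use both interior_subset[of S] in blast)+
    qed
    then have "p \<in> interior S"
      using opn[of r] r \<Phi>0(1) by (auto intro!: interiorI[of "\<Phi> ` ball 0 r"])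
    then show False using p by simp
  qed
  have not_both_out: "\<not> (\<Phi> ` ?U \<inter> S = {} \<and> \<Phi> ` ?L \<inter> S = {})"
  proof
    assume both: "\<Phi> ` ?U \<inter> S = {} \<and> \<Phi> ` ?L \<inter> S = {}"
    have "p \<in> closure (interior S)" "p \<in> \<Phi> ` ball 0 r"
      using p clo r \<Phi>0(1) by auto
    then have "\<Phi> ` ball 0 r \<inter> interior S \<noteq> {}"
      using open_Int_closure_eq_empty[OF opn[OF order_refl], of "interior S"] by blast
    then obtain z where z: "z \<in> ball 0 r" "\<Phi> z \<in> interior S" by blast
    then have "\<Phi> z \<in> S" using interior_subset by blast
    consider "z \<in> ?U" | "z \<in> ?L" | "snd z = 0" using z(1) by force
    then show False
    proof cases
      case 3 then show ?thesis using curve[OF z(1)] z by auto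
    qed (use both \<open>\<Phi> z \<in> S\<close> in blast)+
  qed
  have U: "\<Phi> ` ?U \<subseteq> interior S \<or> \<Phi> ` ?U \<inter> S = {}"
    by (rule one_side[OF cvx(1)]) auto
  have L: "\<Phi> ` ?L \<subseteq> interior S \<or> \<Phi> ` ?L \<inter> S = {}"
    by (rule one_side[OF cvx(2)]) auto
  show thesis
  proof (cases "\<Phi> ` ?U \<subseteq> interior S")
    case True
    then have out: "\<Phi> ` ?L \<inter> S = {}" using not_both_in L by blast
    show thesis
    proof (rule that[OF m r A \<Phi>0 diff near opn])
      fix z assume z: "z \<in> ball (0::real\<times>real) r"
      consider "z \<in> ?U" | "z \<in> ?L" | "snd z = 0" using z by force
      then have "(\<Phi> z \<in> interior S \<longleftrightarrow> 0 < snd z) \<and> (\<Phi> z \<in> S \<longleftrightarrow> 0 \<le> snd z)"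
      proof cases
        case 1 then have "\<Phi> z \<in> interior S" using True by blast
        then show ?thesis using 1 interior_subset[of S] by auto
      next
        case 2 then have "\<Phi> z \<notin> S" using out by blast
        then show ?thesis using 2 interior_subset[of S] by auto
      next
        case 3 then show ?thesis using curve[OF z] by auto
      qed
      then show "\<Phi> z \<in> interior S \<longleftrightarrow> 0 < snd z" "\<Phi> z \<in> S \<longleftrightarrow> 0 \<le> snd z" by auto
    qed auto
  next
    case False
    then have out: "\<Phi> ` ?U \<inter> S = {}" and inn: "\<Phi> ` ?L \<subseteq> interior S"
      using U L not_both_out by blast+
    have neg: "(uminus has_derivative uminus) (at (z::real\<times>real))" for z
      by (auto intro!: derivative_eq_intros)
    have img: "(\<lambda>z. \<Phi> (- z)) ` ball 0 \<rho> = \<Phi> ` ball 0 \<rho>" for \<rho>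
    proof -
      have "(\<lambda>z. \<Phi> (- z)) ` ball 0 \<rho> = \<Phi> ` (uminus ` ball 0 \<rho>)" by (simp add: image_image)
      also have "uminus ` ball (0::real\<times>real) \<rho> = ball 0 \<rho>"
      proof (intro equalityI subsetI)
        fix z assume "z \<in> ball (0::real\<times>real) \<rho>"
        then have "- (- z) \<in> uminus ` ball 0 \<rho>" by (intro imageI) simp
        then show "z \<in> uminus ` ball 0 \<rho>" by simp
      next
        fix z assume "z \<in> uminus ` ball (0::real\<times>real) \<rho>"
        then obtain w where "z = - w" "w \<in> ball 0 \<rho>" by blast
        then show "z \<in> ball 0 \<rho>" by simp
      qed
      finally show ?thesis .
    qed
    show thesis
    proof (rule that[where \<Phi> = "\<lambda>z. \<Phi> (- z)" and A = "\<lambda>z. A (- z)", OF m r])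
      show "linear (\<lambda>z. A (- z))"
        using A(1) by (simp add: linear_iff linear_add[OF A(1)] linear_cmul[OF A(1)] linear_neg[OF A(1)])
      show "((\<lambda>z. \<Phi> (- z)) has_derivative (\<lambda>z. A (- z))) (at 0)"
        using has_derivative_compose[of uminus uminus 0 UNIV \<Phi> A] neg[of 0] \<Phi>0 by simp
      show "\<exists>P. ((\<lambda>z. \<Phi> (- z)) has_derivative P) (at z) \<and> (\<forall>h. norm (P h) \<le> 3 / 2 * m * norm h)"
        if "z \<in> ball 0 r" for z
      proof -
        have "- z \<in> ball 0 r" using that by simp
        from diff[OF this] obtain P
          where P: "(\<Phi> has_derivative P) (at (- z))" "\<forall>h. norm (P h) \<le> 3 / 2 * m * norm h"
          by blast
        have "((\<lambda>z. \<Phi> (- z)) has_derivative (\<lambda>h. P (- h))) (at z)"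
          using has_derivative_compose[of uminus uminus z UNIV \<Phi> P] neg[of z] P(1) by simp
        moreover have "norm (P (- h)) \<le> 3 / 2 * m * norm h" for h
          using P(2)[rule_format, of "- h"] by simp
        ultimately show ?thesis by (intro exI[of _ "\<lambda>h. P (- h)"] conjI allI)
      qed
      show "norm (\<Phi> (- z) - \<Phi> (- w) - A (- (z - w))) \<le> m / 2 * norm (z - w)"
        if "z \<in> ball 0 r" "w \<in> ball 0 r" for z w
        using near[of "- z" "- w"] that by (simp add: norm_minus_commute)
      fix z assume z: "z \<in> ball (0::real\<times>real) r"
      then have z': "- z \<in> ball 0 r" by simp
      consider "- z \<in> ?U" | "- z \<in> ?L" | "snd z = 0" using z by force
      then have "(\<Phi> (- z) \<in> interior S \<longleftrightarrow> 0 < snd z) \<and> (\<Phi> (- z) \<in> S \<longleftrightarrow> 0 \<le> snd z)"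
      proof cases
        case 1 then have "\<Phi> (- z) \<notin> S" using out by blast
        then show ?thesis using 1 interior_subset[of S] by auto
      next
        case 2 then have "\<Phi> (- z) \<in> interior S" using inn by blast
        then show ?thesis using 2 interior_subset[of S] by auto
      next
        case 3 then show ?thesis using curve[OF z'] by auto
      qed
      then show "\<Phi> (- z) \<in> interior S \<longleftrightarrow> 0 < snd z" "\<Phi> (- z) \<in> S \<longleftrightarrow> 0 \<le> snd z" by auto
    qed (use A \<Phi>0 opn img in auto)
  qed
qed

section \<open>Uniqueness of derivatives up to the boundary\<close>

text \<open>At a boundary point the chart pulls two derivatives of \<open>F\<close> back to derivatives, within a half
  ball, of the same function; these agree on both basis vectors, and the derivative of the chart is
  onto.\<close>

lemma planar_domain_derivative_unique:
  fixes F :: "real \<times> real \<Rightarrow> 'b :: real_normed_vector"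
  assumes S: "planar_domain S" and p: "p \<in> S"
    and D1: "(F has_derivative D1) (at p within S)" and D2: "(F has_derivative D2) (at p within S)"
  shows "D1 = D2"
proof (cases "p \<in> interior S")
  case True
  then have "at p within S = at p" by (rule at_within_interior)
  then show ?thesis using D1 D2 by (auto intro: has_derivative_unique)
next
  case False
  with p have pb: "p \<in> S - interior S" by blast
  obtain \<Phi> A :: "real \<times> real \<Rightarrow> real \<times> real" and m r
    where m: "0 < m" and r: "0 < r" and A: "linear A" "\<And>z. norm (A z) = m * norm z"
      and \<Phi>: "\<Phi> 0 = p" "(\<Phi> has_derivative A) (at 0)"
      and side: "\<And>z. z \<in> ball 0 r \<Longrightarrow> \<Phi> z \<in> S \<longleftrightarrow> 0 \<le> snd z"
    by (rule boundary_chart[OF S pb]) (rule that; assumption)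
  define H where "H = {z \<in> ball (0 :: real \<times> real) r. 0 \<le> snd z}"
  have sub: "\<Phi> ` H \<subseteq> S" using side by (auto simp: H_def)
  have \<Phi>H: "(\<Phi> has_derivative A) (at 0 within H)" using \<Phi>(2) by (rule has_derivative_at_withinI)
  have comp: "((F \<circ> \<Phi>) has_derivative D \<circ> A) (at 0 within H)"
    if "(F has_derivative D) (at p within S)" for D
    using \<Phi>(1) that by (intro diff_chain_within[OF \<Phi>H] has_derivative_subset[OF _ sub]) simp
  have "D1 \<circ> A = D2 \<circ> A"
  proof (rule frechet_derivative_unique_within[OF comp[OF D1] comp[OF D2]])
    fix i :: "real \<times> real" and e :: real assume i: "i \<in> Basis" and "e > 0"
    \<comment> \<open>Positive \<open>d\<close> is needed: only the upper half of the vertical axis lies in \<open>H\<close>.\<close>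
    define d where "d = min e r / 2"
    have "0 < \<bar>d\<bar>" "\<bar>d\<bar> < e" "\<bar>d\<bar> < r" using \<open>e > 0\<close> r by (auto simp: d_def)
    moreover have "0 + d *\<^sub>R i \<in> H"
      using i \<open>\<bar>d\<bar> < r\<close> \<open>e > 0\<close> r by (auto simp: H_def Basis_prod_def norm_Pair d_def)
    ultimately show "\<exists>d. 0 < \<bar>d\<bar> \<and> \<bar>d\<bar> < e \<and> 0 + d *\<^sub>R i \<in> H" by blast
  qed
  moreover have "surj A"
  proof (rule linear_inj_imp_surj[OF A(1)])
    show "inj A" unfolding linear_injective_0[OF A(1)]
    proof (intro allI impI)
      fix z assume "A z = 0"
      then have "m * norm z = 0" using A(2)[of z] by simp
      then show "z = 0" using m by simp
    qed
  qed
  ultimately show ?thesis by (metis surj_fun_eq comp_apply fun_eq_iff)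
qed

section \<open>Extending primitives to the boundary\<close>

text \<open>A mean value estimate for increments between any two interior points near \<open>p\<close>. When \<open>p\<close> is on
  the boundary, the segment joining them may leave \<open>S\<close>; so the mean value theorem is applied
  instead to \<open>(u - L) \<circ> \<Phi>\<close> on the convex upper half ball of a boundary chart. The Lipschitz
  constants of \<open>\<Phi>\<close> and of its inverse, \<open>3 / 2 * m\<close> and \<open>2 / m\<close>, account for the factor \<open>3\<close>.\<close>

lemma planar_domain_increment_bound:
  fixes u :: "real \<times> real \<Rightarrow> real"
  assumes S: "planar_domain S" and p: "p \<in> S"
    and u: "\<And>q. q \<in> interior S \<Longrightarrow> (u has_derivative D q) (at q)"
    and L: "bounded_linear L"
    and W: "open W" "p \<in> W" and e: "0 \<le> e"
    and close: "\<And>q h. q \<in> interior S \<inter> W \<Longrightarrow> norm (D q h - L h) \<le> e * norm h"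
  obtains V where "open V" "p \<in> V"
    "\<And>q q'. q \<in> interior S \<inter> V \<Longrightarrow> q' \<in> interior S \<inter> V \<Longrightarrow>
        norm (u q - u q' - L (q - q')) \<le> 3 * e * norm (q - q')"
proof (cases "p \<in> interior S")
  case True
  then obtain \<rho> where \<rho>: "\<rho> > 0" "ball p \<rho> \<subseteq> interior S \<inter> W"
    using W by (meson IntI open_Int open_contains_ball open_interior)
  show thesis
  proof (rule that[of "ball p \<rho>"])
    fix q q' assume q: "q \<in> interior S \<inter> ball p \<rho>" "q' \<in> interior S \<inter> ball p \<rho>"
    have "norm ((u q - L q) - (u q' - L q')) \<le> e * norm (q - q')"
    proof (rule differentiable_bound[OF convex_ball])
      fix x assume x: "x \<in> ball p \<rho>"
      then show "((\<lambda>q. u q - L q) has_derivative (\<lambda>h. D x h - L h)) (at x within ball p \<rho>)"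
        using \<rho> by (intro has_derivative_diff has_derivative_at_withinI[OF u]
            bounded_linear_imp_has_derivative L) auto
      show "onorm (\<lambda>h. D x h - L h) \<le> e"
        by (rule onorm_le) (rule close, use x \<rho> in blast)
    qed (use q in auto)
    moreover have "u q - L q - (u q' - L q') = u q - u q' - L (q - q')"
      by (simp add: linear_diff[OF bounded_linear.linear[OF L]])
    moreover have "e * norm (q - q') \<le> 3 * e * norm (q - q')" using e by simp
    ultimately show "norm (u q - u q' - L (q - q')) \<le> 3 * e * norm (q - q')" by simp
  qed (use \<rho> in auto)
next
  case False
  with p have pb: "p \<in> S - interior S" by blast
  obtain \<Phi> A :: "real \<times> real \<Rightarrow> real \<times> real" and m r
    where m: "0 < m" and r: "0 < r" and A: "\<And>z. norm (A z) = m * norm z" and \<Phi>0: "\<Phi> 0 = p"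
      and diff: "\<And>z. z \<in> ball 0 r \<Longrightarrow> \<exists>P. (\<Phi> has_derivative P) (at z) \<and> (\<forall>h. norm (P h) \<le> 3 / 2 * m * norm h)"
      and near: "\<And>z w. z \<in> ball 0 r \<Longrightarrow> w \<in> ball 0 r \<Longrightarrow> norm (\<Phi> z - \<Phi> w - A (z - w)) \<le> m / 2 * norm (z - w)"
      and opn: "\<And>\<rho>. \<rho> \<le> r \<Longrightarrow> open (\<Phi> ` ball 0 \<rho>)"
      and int: "\<And>z. z \<in> ball 0 r \<Longrightarrow> \<Phi> z \<in> interior S \<longleftrightarrow> 0 < snd z"
    by (rule boundary_chart[OF S pb]) (rule that; assumption)
  have "isCont \<Phi> 0" using diff[of 0] r has_derivative_continuous by force
  then obtain \<rho>0 where \<rho>0: "\<rho>0 > 0" "\<Phi> ` ball 0 \<rho>0 \<subseteq> W"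
    using W \<Phi>0 unfolding continuous_at_open
    by (metis image_subsetI open_contains_ball subset_iff)
  define \<rho> where "\<rho> = min \<rho>0 r"
  have \<rho>: "\<rho> > 0" "\<rho> \<le> r" "\<Phi> ` ball 0 \<rho> \<subseteq> W" using \<rho>0 r by (auto simp: \<rho>_def)
  define H where "H = ball 0 \<rho> \<inter> {z :: real \<times> real. 0 < snd z}"
  have "convex H" unfolding H_def by (intro convex_Int convex_ball convex_upper_half_plane)
  have H_int: "\<Phi> z \<in> interior S \<inter> W" if "z \<in> H" for z
    using that \<rho> int[of z] by (auto simp: H_def)
  show thesis
  proof (rule that[of "\<Phi> ` ball 0 \<rho>"])
    show "p \<in> \<Phi> ` ball 0 \<rho>" using \<Phi>0 \<rho> by force
    fix q q' assume q: "q \<in> interior S \<inter> \<Phi> ` ball 0 \<rho>" "q' \<in> interior S \<inter> \<Phi> ` ball 0 \<rho>"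
    obtain z where z: "z \<in> H" "\<Phi> z = q" using q(1) int \<rho> by (fastforce simp: H_def)
    obtain z' where z': "z' \<in> H" "\<Phi> z' = q'" using q(2) int \<rho> by (fastforce simp: H_def)
    have "norm ((u (\<Phi> z) - L (\<Phi> z)) - (u (\<Phi> z') - L (\<Phi> z'))) \<le> (e * (3 / 2 * m)) * norm (z - z')"
    proof -
      have "\<exists>E. ((\<lambda>z. u (\<Phi> z) - L (\<Phi> z)) has_derivative E) (at x within H) \<and> onorm E \<le> e * (3 / 2 * m)"
        if x: "x \<in> H" for x
      proof -
        obtain P where P: "(\<Phi> has_derivative P) (at x)" "\<And>h. norm (P h) \<le> 3 / 2 * m * norm h"
          using diff[of x] x \<rho> by (auto simp: H_def)
        have "((\<lambda>z. u (\<Phi> z) - L (\<Phi> z)) has_derivative (\<lambda>h. D (\<Phi> x) (P h) - L (P h))) (at x)"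
          using H_int[OF x] by (intro has_derivative_diff has_derivative_compose[OF P(1)] u
              bounded_linear_imp_has_derivative L) auto
        moreover have "norm (D (\<Phi> x) (P h) - L (P h)) \<le> e * (3 / 2 * m) * norm h" for h
        proof -
          have "norm (D (\<Phi> x) (P h) - L (P h)) \<le> e * norm (P h)" using H_int[OF x] by (rule close)
          also have "\<dots> \<le> e * (3 / 2 * m * norm h)" using e P(2) by (rule mult_left_mono[rotated])
          finally show ?thesis by (simp add: mult.assoc)
        qed
        ultimately show ?thesis
          by (intro exI[of _ "\<lambda>h. D (\<Phi> x) (P h) - L (P h)"] conjI onorm_le)
             (rule has_derivative_at_withinI)
      qed
      then obtain E where "\<And>x. x \<in> H \<Longrightarrow> ((\<lambda>z. u (\<Phi> z) - L (\<Phi> z)) has_derivative E x) (at x within H)"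
        "\<And>x. x \<in> H \<Longrightarrow> onorm (E x) \<le> e * (3 / 2 * m)" by metis
      from differentiable_bound[OF \<open>convex H\<close> this z(1) z'(1)] show ?thesis .
    qed
    moreover have "m / 2 * norm (z - z') \<le> norm (q - q')"
    proof -
      have "norm (\<Phi> z - \<Phi> z' - A (z - z')) \<le> m / 2 * norm (z - z')"
        using z z' \<rho> by (intro near) (auto simp: H_def)
      then show ?thesis
        using norm_triangle_ineq2[of "A (z - z')" "\<Phi> z - \<Phi> z'"]
        by (simp add: A z z' norm_minus_commute)
    qed
    then have "3 * e * (m / 2 * norm (z - z')) \<le> 3 * e * norm (q - q')"
      using e by (intro mult_left_mono) auto
    moreover have "u q - L q - (u q' - L q') = u q - u q' - L (q - q')"
      by (simp add: linear_diff[OF bounded_linear.linear[OF L]])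
    ultimately show "norm (u q - u q' - L (q - q')) \<le> 3 * e * norm (q - q')"
      by (simp add: z z' mult_ac)
  qed (use opn \<rho> in auto)
qed

lemma planar_domain_islimpt_interior:
  assumes S: "planar_domain S" and "p \<in> S"
  shows "p islimpt interior S"
proof (cases "p \<in> interior S")
  case True then show ?thesis by (simp add: interior_limit_point)
next
  case False
  moreover have "p \<in> closure (interior S)" using assms by (auto simp: planar_domain_def)
  ultimately show ?thesis by (simp add: closure_def)
qed

text \<open>By the increment bound \<open>u\<close> is Lipschitz near each point of \<open>S\<close>, so it has a limit there, which
  serves as the value of the extension. The derivative at \<open>p\<close> comes from the same bound with \<open>L\<close> the
  claimed derivative: letting the second point tend to \<open>p\<close> and then the first to an arbitrary
  point of \<open>S\<close> turns it into the estimate defining differentiability.\<close>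

lemma planar_domain_primitive_extends:
  fixes u :: "real \<times> real \<Rightarrow> real"
  assumes S: "planar_domain S"
    and u: "\<And>q. q \<in> interior S \<Longrightarrow> (u has_derivative (\<lambda>h. f q * fst h + g q * snd h)) (at q)"
    and cont: "continuous_on S f" "continuous_on S g"
  obtains U where "\<And>p. p \<in> S \<Longrightarrow> (U has_derivative (\<lambda>h. f p * fst h + g p * snd h)) (at p within S)"
proof -
  let ?L = "\<lambda>p h. f p * fst h + g p * snd (h :: real \<times> real)"
  have nontriv: "\<not> trivial_limit (at p within interior S)" if "p \<in> S" for p
    using planar_domain_islimpt_interior[OF S that] by (simp add: trivial_limit_within)
  have bl: "bounded_linear (?L p)" for p
    by (intro bounded_linear_intros)
  have bound: "\<exists>V. open V \<and> p \<in> V \<and> (\<forall>q\<in>interior S \<inter> V. \<forall>q'\<in>interior S \<inter> V.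
      \<bar>u q - u q' - ?L p (q - q')\<bar> \<le> e * norm (q - q'))" if p: "p \<in> S" and e: "e > 0" for p e
  proof -
    have "e / 6 > 0" using e by simp
    then obtain \<delta>1 \<delta>2 where \<delta>: "\<delta>1 > 0" "\<And>q. q \<in> S \<Longrightarrow> dist q p < \<delta>1 \<Longrightarrow> dist (f q) (f p) < e / 6"
      "\<delta>2 > 0" "\<And>q. q \<in> S \<Longrightarrow> dist q p < \<delta>2 \<Longrightarrow> dist (g q) (g p) < e / 6"
      using cont p unfolding continuous_on_iff by metis
    define \<delta> where "\<delta> = min \<delta>1 \<delta>2"
    obtain V where "open V" "p \<in> V" "\<And>q q'. q \<in> interior S \<inter> V \<Longrightarrow> q' \<in> interior S \<inter> V \<Longrightarrow>
        norm (u q - u q' - ?L p (q - q')) \<le> 3 * (e / 3) * norm (q - q')"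
    proof (rule planar_domain_increment_bound[OF S p u bl, of "ball p \<delta>" "e / 3"])
      fix q and h :: "real \<times> real" assume q: "q \<in> interior S \<inter> ball p \<delta>"
      then have "q \<in> S" "dist q p < \<delta>" using interior_subset[of S] by (auto simp: dist_commute)
      then have "\<bar>f q - f p\<bar> < e / 6" "\<bar>g q - g p\<bar> < e / 6"
        using \<delta>(2)[of q] \<delta>(4)[of q] by (simp_all add: \<delta>_def dist_real_def)
      moreover have "\<bar>fst h\<bar> \<le> norm h" "\<bar>snd h\<bar> \<le> norm h"
        using norm_fst_le[of "fst h" "snd h"] norm_snd_le[of "snd h" "fst h"] by simp_all
      ultimately have "\<bar>(f q - f p) * fst h\<bar> \<le> e / 6 * norm h" "\<bar>(g q - g p) * snd h\<bar> \<le> e / 6 * norm h"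
        unfolding abs_mult using e by (intro mult_mono; simp)+
      moreover have "?L q h - ?L p h = (f q - f p) * fst h + (g q - g p) * snd h"
        by (simp add: algebra_simps)
      ultimately show "norm (?L q h - ?L p h) \<le> e / 3 * norm h"
        using abs_triangle_ineq[of "(f q - f p) * fst h" "(g q - g p) * snd h"] by simp
    qed (use e \<delta> in \<open>auto simp: \<delta>_def\<close>)
    then show ?thesis by auto
  qed
  define U where "U p = Lim (at p within interior S) u" for p
  have U: "(u \<longlongrightarrow> U p) (at p within interior S)" if p: "p \<in> S" for p
  proof -
    obtain V where V: "open V" "p \<in> V" and
      Vb: "\<And>q q'. q \<in> interior S \<inter> V \<Longrightarrow> q' \<in> interior S \<inter> V \<Longrightarrow>
            \<bar>u q - u q' - ?L p (q - q')\<bar> \<le> 1 * norm (q - q')"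
      using bound[OF p, of 1] by auto
    obtain K where K: "\<And>h. norm (?L p h) \<le> norm h * K" using bounded_linear.bounded[OF bl[of p]] by blast
    have lip: "dist (u q) (u q') \<le> (1 + \<bar>K\<bar>) * dist q q'"
      if "q \<in> interior S \<inter> V" "q' \<in> interior S \<inter> V" for q q'
    proof -
      have "norm (q - q') * K \<le> norm (q - q') * \<bar>K\<bar>" by (intro mult_left_mono) auto
      then show ?thesis using Vb[OF that] K[of "q - q'"]
        by (simp add: dist_norm algebra_simps)
    qed
    have "uniformly_continuous_on (interior S \<inter> V) u"
      using lip by (intro lipschitz_on_uniformly_continuous[of "1 + \<bar>K\<bar>"] lipschitz_onI) auto
    moreover have "p \<in> closure (interior S \<inter> V)"
      using p S V open_Int_closure_subset[of V "interior S"] by (auto simp: planar_domain_def Int_commute)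
    ultimately obtain l where "(u \<longlongrightarrow> l) (at p within interior S \<inter> V)"
      by (rule uniformly_continuous_on_extension_at_closure)
    then have l: "(u \<longlongrightarrow> l) (at p within interior S)"
      using at_within_nhd[OF V(2,1), of "interior S \<inter> V" "interior S"] by auto
    with tendsto_Lim[OF nontriv[OF p] l] show ?thesis by (simp add: U_def)
  qed
  show thesis
  proof (rule that[of U])
    fix p assume p: "p \<in> S"
    show "(U has_derivative ?L p) (at p within S)"
      unfolding has_derivative_within_alt
    proof (intro conjI allI impI)
      show "bounded_linear (?L p)" by (rule bl)
      fix e :: real assume "e > 0"
      then obtain V where V: "open V" "p \<in> V" and
        Vb: "\<And>q q'. q \<in> interior S \<inter> V \<Longrightarrow> q' \<in> interior S \<inter> V \<Longrightarrow>
              \<bar>u q - u q' - ?L p (q - q')\<bar> \<le> e * norm (q - q')"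
        using bound[OF p] by meson
      have near: "eventually (\<lambda>q. q \<in> interior S \<inter> V) (at x within interior S)" if "x \<in> V" for x
        using V(1) that unfolding eventually_at_topological by blast
      have lim: "((\<lambda>q. ?L p (q - a)) \<longlongrightarrow> ?L p (x - a)) (at x within X)"
        "((\<lambda>q. ?L p (a - q)) \<longlongrightarrow> ?L p (a - x)) (at x within X)" for x a X
        by (auto intro!: tendsto_eq_intros)
      \<comment> \<open>First \<open>q'\<close> tends to \<open>p\<close>.\<close>
      have one: "\<bar>u q - U p - ?L p (q - p)\<bar> \<le> e * norm (q - p)" if q: "q \<in> interior S \<inter> V" for q
      proof (rule tendsto_le[OF nontriv[OF p]])
        show "((\<lambda>q'. \<bar>u q - u q' - ?L p (q - q')\<bar>) \<longlongrightarrow> \<bar>u q - U p - ?L p (q - p)\<bar>) (at p within interior S)"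
          by (intro tendsto_intros U p lim)
        show "((\<lambda>q'. e * norm (q - q')) \<longlongrightarrow> e * norm (q - p)) (at p within interior S)"
          by (intro tendsto_intros)
        show "\<forall>\<^sub>F q' in at p within interior S. \<bar>u q - u q' - ?L p (q - q')\<bar> \<le> e * norm (q - q')"
          using near[OF V(2)] by eventually_elim (rule Vb[OF q])
      qed
      \<comment> \<open>Then the remaining interior point tends to \<open>q\<close>.\<close>
      have two: "\<bar>U q - U p - ?L p (q - p)\<bar> \<le> e * norm (q - p)" if q: "q \<in> S" "q \<in> V" for q
      proof (rule tendsto_le[OF nontriv[OF q(1)]])
        show "((\<lambda>q'. \<bar>u q' - U p - ?L p (q' - p)\<bar>) \<longlongrightarrow> \<bar>U q - U p - ?L p (q - p)\<bar>) (at q within interior S)"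
          by (intro tendsto_intros U q lim)
        show "((\<lambda>q'. e * norm (q' - p)) \<longlongrightarrow> e * norm (q - p)) (at q within interior S)"
          by (intro tendsto_intros)
        show "\<forall>\<^sub>F q' in at q within interior S. \<bar>u q' - U p - ?L p (q' - p)\<bar> \<le> e * norm (q' - p)"
          using near[OF q(2)] by eventually_elim (rule one)
      qed
      obtain d where "d > 0" "ball p d \<subseteq> V" using V open_contains_ball by metis
      then show "\<exists>d>0. \<forall>y\<in>S. norm (y - p) < d \<longrightarrow> norm (U y - U p - ?L p (y - p)) \<le> e * norm (y - p)"
        using two by (intro exI[of _ d]) (auto simp: subset_iff dist_norm norm_minus_commute)
    qed
  qed
qed

section \<open>Closed 1-forms on the interior\<close>

text \<open>The integral \<open>U z = integral {0..1} (\<lambda>t. c (t z) \<bullet> z)\<close> along the radius is a primitive: differentiating under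
  the integral in direction \<open>h\<close> gives \<open>t (C (t z) h \<bullet> z) + c (t z) \<bullet> h\<close>, which by symmetry of \<open>C\<close> is the
  \<open>t\<close>-derivative of \<open>t (c (t z) \<bullet> h)\<close>. A 1-form is written here as the inner product with a vector
  field \<open>c\<close>; symmetry of the derivative of \<open>c\<close> means that the form is closed.\<close>

lemma Poincare_lemma_ball:
  fixes c :: "'a :: euclidean_space \<Rightarrow> 'a"
  assumes deriv: "\<And>z. z \<in> ball 0 R \<Longrightarrow> (c has_derivative C z) (at z)"
    and cont: "\<And>h. continuous_on (ball 0 R) (\<lambda>z. C z h)"
    and sym: "\<And>z h k. z \<in> ball 0 R \<Longrightarrow> C z h \<bullet> k = C z k \<bullet> h"
  obtains U where "\<And>z. z \<in> ball 0 R \<Longrightarrow> (U has_derivative (\<lambda>h. c z \<bullet> h)) (at z)"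
proof -
  let ?D = "ball (0::'a) R"
  define U where "U z = integral {0..1} (\<lambda>t. c (t *\<^sub>R z) \<bullet> z)" for z
  define F where "F z t h = t * (C (t *\<^sub>R z) h \<bullet> z) + c (t *\<^sub>R z) \<bullet> h" for z t h
  have D: "t *\<^sub>R z \<in> ?D" if "z \<in> ?D" "t \<in> {0..1}" for z t
  proof -
    have "t * norm z \<le> 1 * norm z" using that by (intro mult_right_mono) auto
    then show ?thesis using that by simp
  qed
  have contc: "continuous_on ?D c"
    using deriv by (meson continuous_at_imp_continuous_on has_derivative_continuous)
  have der: "((\<lambda>z. c (t *\<^sub>R z) \<bullet> z) has_derivative F z t) (at z)" if "z \<in> ?D" "t \<in> {0..1}" for z t
  proof -
    have "((\<lambda>z. t *\<^sub>R z) has_derivative (\<lambda>h. t *\<^sub>R h)) (at z)" by (auto intro!: derivative_eq_intros)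
    from has_derivative_compose[OF this deriv[OF D[OF that]]]
    have 1: "((\<lambda>z. c (t *\<^sub>R z)) has_derivative (\<lambda>h. C (t *\<^sub>R z) (t *\<^sub>R h))) (at z)" .
    have "linear (C (t *\<^sub>R z))" using deriv[OF D[OF that]] by (simp add: has_derivative_linear)
    then have "C (t *\<^sub>R z) (t *\<^sub>R h) = t *\<^sub>R C (t *\<^sub>R z) h" for h by (rule linear_cmul)
    with 1 have "((\<lambda>z. c (t *\<^sub>R z)) has_derivative (\<lambda>h. t *\<^sub>R C (t *\<^sub>R z) h)) (at z)" by simp
    from has_derivative_inner[OF this has_derivative_ident]
    show ?thesis by (simp add: F_def[abs_def] algebra_simps)
  qed
  have bl: "bounded_linear (F z t)" if "z \<in> ?D" "t \<in> {0..1}" for z t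
    using der[OF that] by (rule has_derivative_bounded_linear)
  have D': "(\<lambda>(z, t). t *\<^sub>R z) ` (?D \<times> {0..1}) \<subseteq> ?D" using D by auto
  have contF: "continuous_on (?D \<times> {0..1}) (\<lambda>(z, t). F z t h)" for h
  proof -
    have cs: "continuous_on (?D \<times> {0..1}) (\<lambda>(z, t). t *\<^sub>R z)"
      by (auto simp: split_beta intro!: continuous_intros)
    have "continuous_on (?D \<times> {0..1}) (\<lambda>x. C (snd x *\<^sub>R fst x) h)"
      "continuous_on (?D \<times> {0..1}) (\<lambda>x. c (snd x *\<^sub>R fst x))"
      using continuous_on_compose2[OF cont cs D'] continuous_on_compose2[OF contc cs D']
      by (simp_all add: split_beta)
    then show ?thesis unfolding F_def by (auto simp: split_beta intro!: continuous_intros)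
  qed
  have "(U has_derivative (\<lambda>h. c z \<bullet> h)) (at z)" if z: "z \<in> ?D" for z
  proof -
    have "((\<lambda>z. integral (cbox 0 1) (\<lambda>t. c (t *\<^sub>R z) \<bullet> z)) has_derivative
        integral (cbox 0 1) (\<lambda>t. Blinfun (F z t))) (at z within ?D)"
    proof (rule leibniz_rule[where U = ?D and fx = "\<lambda>z t. Blinfun (F z t)"])
      show "((\<lambda>z. c (t *\<^sub>R z) \<bullet> z) has_derivative blinfun_apply (Blinfun (F x t))) (at x within ?D)"
        if "x \<in> ?D" "t \<in> cbox 0 1" for x and t :: real
        using that der[of x t] bl[of x t] by (simp add: bounded_linear_Blinfun_apply has_derivative_at_withinI)
      show "(\<lambda>t. c (t *\<^sub>R x) \<bullet> x) integrable_on cbox 0 (1::real)" if "x \<in> ?D" for x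
        using D that by (intro integrable_continuous continuous_intros continuous_on_compose2[OF contc]) auto
      show "continuous_on (?D \<times> cbox 0 1) (\<lambda>(x, t). Blinfun (F x t))"
      proof (rule continuous_on_blinfun_componentwise)
        fix i :: 'a
        show "continuous_on (?D \<times> cbox 0 1) (\<lambda>x. blinfun_apply (case x of (x, t) \<Rightarrow> Blinfun (F x t)) i)"
          unfolding cbox_interval using contF[of i] by (rule continuous_on_eq) (auto simp: bounded_linear_Blinfun_apply bl)
      qed
    qed (use z in auto)
    moreover have "blinfun_apply (integral (cbox 0 1) (\<lambda>t. Blinfun (F z t))) = (\<lambda>h. c z \<bullet> h)"
    proof
      fix h
      have cb: "continuous_on {0..1} (\<lambda>t. Blinfun (F z t))"
      proof (rule continuous_on_blinfun_componentwise)
        fix i :: 'a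
        have "continuous_on {0..1} (\<lambda>t. F z t i)"
          using z by (intro continuous_on_compose2[OF contF[of i], of _ "\<lambda>t. (z, t)", simplified] continuous_intros) auto
        then show "continuous_on {0..1} (\<lambda>t. blinfun_apply (Blinfun (F z t)) i)"
          by (rule continuous_on_eq) (simp add: bounded_linear_Blinfun_apply[OF bl[OF z]])
      qed
      have "blinfun_apply (integral (cbox 0 1) (\<lambda>t. Blinfun (F z t))) h
          = integral {0..1} (\<lambda>t. blinfun_apply (Blinfun (F z t)) h)"
        using integral_linear[OF integrable_continuous_real[OF cb] blinfun.bounded_linear_left, of h]
        by (simp add: o_def)
      also have "\<dots> = integral {0..1} (\<lambda>t. F z t h)"
        by (intro integral_cong) (simp add: bounded_linear_Blinfun_apply[OF bl[OF z]])
      also have "\<dots> = 1 * (c (1 *\<^sub>R z) \<bullet> h) - 0 * (c (0 *\<^sub>R z) \<bullet> h)"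
      proof (intro integral_unique fundamental_theorem_of_calculus)
        fix t :: real assume t: "t \<in> {0..1}"
        have "((\<lambda>t. t *\<^sub>R z) has_derivative (\<lambda>s. s *\<^sub>R z)) (at t)" by (auto intro!: derivative_eq_intros)
        from has_derivative_compose[OF this deriv[OF D[OF z t]]]
        have 1: "((\<lambda>t. c (t *\<^sub>R z)) has_derivative (\<lambda>s. C (t *\<^sub>R z) (s *\<^sub>R z))) (at t)" .
        have "linear (C (t *\<^sub>R z))" using deriv[OF D[OF z t]] by (simp add: has_derivative_linear)
        then have "C (t *\<^sub>R z) (s *\<^sub>R z) = s *\<^sub>R C (t *\<^sub>R z) z" for s by (rule linear_cmul)
        with 1 have "((\<lambda>t. c (t *\<^sub>R z)) has_vector_derivative C (t *\<^sub>R z) z) (at t)"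
          by (simp add: has_vector_derivative_def)
        then have "((\<lambda>t. c (t *\<^sub>R z) \<bullet> h) has_real_derivative C (t *\<^sub>R z) z \<bullet> h) (at t)"
          unfolding has_real_derivative_iff_has_vector_derivative
          by (rule bounded_linear.has_vector_derivative[OF bounded_linear_inner_left])
        from DERIV_mult[OF DERIV_ident this]
        have "((\<lambda>t. t * (c (t *\<^sub>R z) \<bullet> h)) has_real_derivative F z t h) (at t)"
          by (simp only: F_def sym[OF D[OF z t], of z h] mult_1 mult.commute add.commute)
        then show "((\<lambda>t. t * (c (t *\<^sub>R z) \<bullet> h)) has_vector_derivative F z t h) (at t within {0..1})"
          by (simp add: has_real_derivative_iff_has_vector_derivative has_vector_derivative_at_within)
      qed auto
      finally show "blinfun_apply (integral (cbox 0 1) (\<lambda>t. Blinfun (F z t))) h = c z \<bullet> h" by simp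
    qed
    ultimately have "(U has_derivative (\<lambda>h. c z \<bullet> h)) (at z within ?D)"
      unfolding U_def by simp
    then show ?thesis by (simp only: at_within_open[OF z open_ball])
  qed
  then show thesis by (rule that)
qed

text \<open>A Riemann map \<open>\<phi>\<close> from the unit disc onto \<open>S\<close> pulls the form back to \<open>b z = cnj (\<phi>' z) * c (\<phi> z)\<close>,
  since multiplication by \<open>cnj w\<close> is the adjoint of multiplication by \<open>w\<close>. The pulled back form is
  again closed, so it has a primitive on the disc, which is carried back to \<open>S\<close> by the inverse of
  \<open>\<phi>\<close>.\<close>

lemma closed_form_exact_simply_connected:
  fixes c :: "complex \<Rightarrow> complex"
  assumes S: "open S" "simply_connected S" "S \<noteq> UNIV"
    and deriv: "\<And>z. z \<in> S \<Longrightarrow> (c has_derivative C z) (at z)"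
    and cont: "\<And>h. continuous_on S (\<lambda>z. C z h)"
    and sym: "\<And>z h k. z \<in> S \<Longrightarrow> C z h \<bullet> k = C z k \<bullet> h"
  obtains u where "\<And>z. z \<in> S \<Longrightarrow> (u has_derivative (\<lambda>h. c z \<bullet> h)) (at z)"
proof -
  show thesis
  proof (cases "S = {}")
    case True
    then show ?thesis using that by blast
  next
    case False
    obtain \<psi> \<phi> where \<psi>: "\<psi> holomorphic_on S" and \<phi>: "\<phi> holomorphic_on ball 0 1"
      and \<psi>\<phi>: "\<And>z. z \<in> S \<Longrightarrow> \<psi> z \<in> ball 0 1 \<and> \<phi> (\<psi> z) = z"
      and \<phi>\<psi>: "\<And>z. z \<in> ball 0 1 \<Longrightarrow> \<phi> z \<in> S \<and> \<psi> (\<phi> z) = z"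
      using False S simply_connected_eq_biholomorphic_to_disc[OF S(1)] by metis
    let ?D = "ball (0::complex) 1"
    have d\<phi>: "(\<phi> has_field_derivative deriv \<phi> z) (at z)" if "z \<in> ?D" for z
      using holomorphic_derivI[OF \<phi> open_ball that] .
    have hol': "deriv \<phi> holomorphic_on ?D" by (rule holomorphic_deriv[OF \<phi> open_ball])
    have dd\<phi>: "(deriv \<phi> has_field_derivative deriv (deriv \<phi>) z) (at z)" if "z \<in> ?D" for z
      using holomorphic_derivI[OF hol' open_ball that] .
    have hol'': "deriv (deriv \<phi>) holomorphic_on ?D" by (rule holomorphic_deriv[OF hol' open_ball])
    have linC: "linear (C z)" if "z \<in> S" for z
      using deriv[OF that] by (rule has_derivative_linear)
    \<comment> \<open>Only continuity of \<open>C z h\<close> for fixed \<open>h\<close> is known, but \<open>B\<close> evaluates \<open>C\<close> at a direction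
      that varies with the point.\<close>
    have C_split: "C z h = Re h *\<^sub>R C z 1 + Im h *\<^sub>R C z \<i>" if "z \<in> S" for z h
    proof -
      have "h = Re h *\<^sub>R 1 + Im h *\<^sub>R \<i>" by (simp add: complex_eq_iff)
      then have "C z h = C z (Re h *\<^sub>R 1 + Im h *\<^sub>R \<i>)" by (rule arg_cong)
      then show ?thesis by (simp only: linear_add[OF linC[OF that]] linear_cmul[OF linC[OF that]])
    qed
    define b where "b z = cnj (deriv \<phi> z) * c (\<phi> z)" for z
    define B where "B z h = cnj (deriv \<phi> z) * C (\<phi> z) (deriv \<phi> z * h) + cnj (deriv (deriv \<phi>) z * h) * c (\<phi> z)" for z h
    obtain U where U: "\<And>z. z \<in> ?D \<Longrightarrow> (U has_derivative (\<lambda>h. b z \<bullet> h)) (at z)"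
    proof (rule Poincare_lemma_ball[of 1 b B])
      fix z :: complex assume z: "z \<in> ?D"
      have 1: "((\<lambda>z. c (\<phi> z)) has_derivative (\<lambda>h. C (\<phi> z) (deriv \<phi> z * h))) (at z)"
        using has_derivative_compose[OF has_field_derivative_imp_has_derivative[OF d\<phi>[OF z]] deriv] \<phi>\<psi> z by simp
      have 2: "((\<lambda>z. cnj (deriv \<phi> z)) has_derivative (\<lambda>h. cnj (deriv (deriv \<phi>) z * h))) (at z)"
        using has_field_derivative_imp_has_derivative[OF dd\<phi>[OF z]] by (rule has_derivative_cnj)
      show "(b has_derivative B z) (at z)"
        unfolding b_def[abs_def] B_def[abs_def] using has_derivative_mult[OF 2 1] by simp
      fix h k :: complex
      have "C (\<phi> z) (deriv \<phi> z * h) \<bullet> (deriv \<phi> z * k) = C (\<phi> z) (deriv \<phi> z * k) \<bullet> (deriv \<phi> z * h)"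
        using sym \<phi>\<psi> z by blast
      then show "B z h \<bullet> k = B z k \<bullet> h"
        by (simp add: B_def inner_complex_def algebra_simps)
    next
      fix h
      have c\<phi>: "continuous_on ?D \<phi>" "continuous_on ?D (deriv \<phi>)" "continuous_on ?D (deriv (deriv \<phi>))"
        using \<phi> hol' hol'' by (auto intro: holomorphic_on_imp_continuous_on)
      have im: "\<phi> ` ?D \<subseteq> S" using \<phi>\<psi> by blast
      have "continuous_on S c"
        using deriv by (meson continuous_at_imp_continuous_on has_derivative_continuous)
      from continuous_on_compose2[OF this c\<phi>(1) im] have cc: "continuous_on ?D (\<lambda>z. c (\<phi> z))" .
      have C': "continuous_on ?D (\<lambda>z. C (\<phi> z) h)" for h
        using continuous_on_compose2[OF cont c\<phi>(1) im] .
      have "continuous_on ?D (\<lambda>z. cnj (deriv \<phi> z) * (Re (deriv \<phi> z * h) *\<^sub>R C (\<phi> z) 1 + Im (deriv \<phi> z * h) *\<^sub>R C (\<phi> z) \<i>)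
           + cnj (deriv (deriv \<phi>) z * h) * c (\<phi> z))"
        by (intro continuous_intros C' cc c\<phi>)
      then show "continuous_on ?D (\<lambda>z. B z h)"
      proof (rule continuous_on_eq)
        fix z assume "z \<in> ?D"
        then have "\<phi> z \<in> S" using im by blast
        from C_split[OF this, of "deriv \<phi> z * h"]
        show "cnj (deriv \<phi> z) * (Re (deriv \<phi> z * h) *\<^sub>R C (\<phi> z) 1 + Im (deriv \<phi> z * h) *\<^sub>R C (\<phi> z) \<i>)
           + cnj (deriv (deriv \<phi>) z * h) * c (\<phi> z) = B z h"
          by (simp only: B_def)
      qed
    qed (rule that, assumption)
    show thesis
    proof (rule that[of "\<lambda>z. U (\<psi> z)"])
      fix z assume z: "z \<in> S"
      have d\<psi>: "(\<psi> has_field_derivative deriv \<psi> z) (at z)"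
        using holomorphic_derivI[OF \<psi> S(1) z] .
      have "((\<lambda>w. \<phi> (\<psi> w)) has_field_derivative deriv \<phi> (\<psi> z) * deriv \<psi> z) (at z)"
        using d\<phi> \<psi>\<phi> z d\<psi> by (intro DERIV_chain2) auto
      moreover have "((\<lambda>w. \<phi> (\<psi> w)) has_field_derivative 1) (at z)"
        using DERIV_ident by (rule has_field_derivative_transform_within_open[OF _ S(1) z]) (use \<psi>\<phi> in auto)
      ultimately have one: "deriv \<phi> (\<psi> z) * deriv \<psi> z = 1" by (rule DERIV_unique)
      have "((\<lambda>z. U (\<psi> z)) has_derivative (\<lambda>h. b (\<psi> z) \<bullet> (deriv \<psi> z * h))) (at z)"
        using has_derivative_compose[OF has_field_derivative_imp_has_derivative[OF d\<psi>] U] \<psi>\<phi> z by simp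
      moreover have "b (\<psi> z) \<bullet> (deriv \<psi> z * h) = c z \<bullet> h" for h
      proof -
        have "b (\<psi> z) \<bullet> (deriv \<psi> z * h) = c z \<bullet> (deriv \<phi> (\<psi> z) * deriv \<psi> z * h)"
          using \<psi>\<phi>[OF z] by (simp add: b_def inner_complex_def algebra_simps)
        then show ?thesis by (simp add: one)
      qed
      ultimately show "((\<lambda>z. U (\<psi> z)) has_derivative (\<lambda>h. c z \<bullet> h)) (at z)" by simp
    qed
  qed
qed

text \<open>Contractibility of \<open>S\<close> says nothing directly about loops in its interior, because
  the contraction need not preserve the interior. But a contractible compact plane set does not separate the plane,
  so \<open>- S\<close> is connected; hence so is its closure, the complement of the interior. An open connected
  bounded plane set with connected complement is simply connected.\<close>

lemma planar_domain_interior_simply_connected: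
  assumes S: "planar_domain S"
  defines "T \<equiv> {z. (Re z, Im z) \<in> interior S}"
  shows "open T" "simply_connected T" "T \<noteq> UNIV"
proof -
  let ?\<kappa> = "\<lambda>p. Complex (fst p) (snd p)" and ?\<iota> = "\<lambda>z. (Re z, Im z)"
  have cont: "continuous_on X ?\<kappa>" "continuous_on Y ?\<iota>" for X Y
    by (auto simp: Complex_eq intro!: continuous_intros)
  have img: "?\<kappa> ` X = {z. ?\<iota> z \<in> X}" "?\<iota> ` Y = {p. ?\<kappa> p \<in> Y}" for X Y
    by (force simp: image_iff)+
  have bnd: "bounded (?\<kappa> ` X)" if "bounded X" for X
  proof -
    have "compact (closure X)" using that by simp
    then have "compact (?\<kappa> ` closure X)" using cont by (intro compact_continuous_image)
    then show ?thesis by (meson bounded_subset closure_subset compact_imp_bounded image_mono)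
  qed
  show "open T"
    unfolding T_def using open_vimage[of "interior S" ?\<iota>] cont(2)[of UNIV]
    by (simp add: vimage_def)
  have T: "T = ?\<kappa> ` interior S" by (simp add: T_def img)
  have bdT: "bounded T"
    using S bnd unfolding T planar_domain_def by (meson bounded_subset interior_subset)
  then show "T \<noteq> UNIV" using not_bounded_UNIV by blast
  define K where "K = ?\<kappa> ` S"
  have "compact K"
    using S cont unfolding K_def planar_domain_def by (intro compact_continuous_image) (auto simp: compact_eq_bounded_closed)
  moreover have "Borsukian K"
  proof -
    have "homeomorphism S K ?\<kappa> ?\<iota>" unfolding homeomorphism_def K_def using cont by force
    then have "S homeomorphic K" unfolding homeomorphic_def by blast
    then show ?thesis
      using S homeomorphic_contractible_eq contractible_imp_Borsukian unfolding planar_domain_def by blast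
  qed
  ultimately have "connected (- K)" by (simp add: Borsukian_separation_compact)
  then have "connected (?\<iota> ` (- K))" using cont by (intro connected_continuous_image)
  moreover have "?\<iota> ` (- K) = - S" unfolding K_def img by auto
  ultimately have "connected (closure (- S))" by (simp add: connected_imp_connected_closure)
  then have "connected (?\<kappa> ` (- interior S))"
    using cont by (intro connected_continuous_image) (simp_all add: closure_complement)
  moreover have "?\<kappa> ` (- interior S) = - T" unfolding T img by auto
  ultimately have conn: "connected (- T)" by simp
  have "inside T = {}"
  proof -
    have False if "x \<in> inside T" for x
    proof -
      have "x \<in> - T" "bounded (connected_component_set (- T) x)" using that by (auto simp: inside_def)
      moreover have "connected_component_set (- T) x = - T"
        using conn \<open>x \<in> - T\<close> by (rule connected_component_eq_self)
      ultimately show False using bdT cobounded_imp_unbounded by metis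
    qed
    then show ?thesis by blast
  qed
  moreover have "connected T"
    unfolding T using S cont by (intro connected_continuous_image) (auto simp: planar_domain_def)
  ultimately show "simply_connected T" using simply_connected_eq_empty_inside[OF \<open>open T\<close>] by simp
qed

lemma closed_form_exact_interior:
  fixes f g :: "real \<times> real \<Rightarrow> real"
  assumes S: "planar_domain S"
    and f: "\<And>p. p \<in> interior S \<Longrightarrow> (f has_derivative (\<lambda>h. fx p * fst h + fy p * snd h)) (at p)"
    and g: "\<And>p. p \<in> interior S \<Longrightarrow> (g has_derivative (\<lambda>h. gx p * fst h + gy p * snd h)) (at p)"
    and cont: "continuous_on (interior S) fx" "continuous_on (interior S) fy"
      "continuous_on (interior S) gx" "continuous_on (interior S) gy"
    and closed: "\<And>p. p \<in> interior S \<Longrightarrow> fy p = gx p"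
  obtains u where "\<And>p. p \<in> interior S \<Longrightarrow> (u has_derivative (\<lambda>h. f p * fst h + g p * snd h)) (at p)"
proof -
  let ?\<iota> = "\<lambda>z. (Re z, Im z)"
  define T where "T = {z. ?\<iota> z \<in> interior S}"
  have T: "open T" "simply_connected T" "T \<noteq> UNIV"
    unfolding T_def using planar_domain_interior_simply_connected[OF S] by auto
  have d\<iota>: "(?\<iota> has_derivative ?\<iota>) (at z)" for z
    by (auto intro!: derivative_eq_intros)
  define c where "c z = Complex (f (?\<iota> z)) (g (?\<iota> z))" for z
  define C where "C z h = Complex (fx (?\<iota> z) * Re h + fy (?\<iota> z) * Im h) (gx (?\<iota> z) * Re h + gy (?\<iota> z) * Im h)"
    for z h
  obtain U where U: "\<And>z. z \<in> T \<Longrightarrow> (U has_derivative (\<lambda>h. c z \<bullet> h)) (at z)"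
  proof (rule closed_form_exact_simply_connected[OF T, of c C])
    fix z assume z: "z \<in> T"
    have "((\<lambda>z. f (?\<iota> z)) has_derivative (\<lambda>h. fx (?\<iota> z) * Re h + fy (?\<iota> z) * Im h)) (at z)"
      "((\<lambda>z. g (?\<iota> z)) has_derivative (\<lambda>h. gx (?\<iota> z) * Re h + gy (?\<iota> z) * Im h)) (at z)"
      using z has_derivative_compose[OF d\<iota> f] has_derivative_compose[OF d\<iota> g] by (simp_all add: T_def)
    then show "(c has_derivative C z) (at z)"
      unfolding c_def[abs_def] C_def[abs_def] Complex_eq
      by (auto intro!: derivative_eq_intros)
    show "C z h \<bullet> k = C z k \<bullet> h" for h k
      using z closed[of "?\<iota> z"] by (simp add: T_def C_def inner_complex_def algebra_simps)
  next
    fix h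
    have "continuous_on T ?\<iota>" "?\<iota> ` T \<subseteq> interior S" by (auto simp: T_def intro!: continuous_intros)
    then show "continuous_on T (\<lambda>z. C z h)"
      unfolding C_def Complex_eq by (auto intro!: continuous_intros continuous_on_compose2[OF cont(1)]
        continuous_on_compose2[OF cont(2)] continuous_on_compose2[OF cont(3)] continuous_on_compose2[OF cont(4)])
  qed (rule that, assumption)
  have d\<kappa>: "((\<lambda>p. Complex (fst p) (snd p)) has_derivative (\<lambda>p. Complex (fst p) (snd p))) (at p)" for p
    unfolding Complex_eq by (auto intro!: derivative_eq_intros)
  show thesis
  proof (rule that[of "\<lambda>p. U (Complex (fst p) (snd p))"])
    fix p assume "p \<in> interior S"
    then have "Complex (fst p) (snd p) \<in> T" by (simp add: T_def)
    from has_derivative_compose[OF d\<kappa> U[OF this]]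
    show "((\<lambda>p. U (Complex (fst p) (snd p))) has_derivative (\<lambda>h. f p * fst h + g p * snd h)) (at p)"
      by (simp add: c_def inner_complex_def)
  qed
qed

section \<open>Symmetry of mixed second derivatives\<close>

text \<open>The mean value theorem is applied to \<open>s \<mapsto> u (s, y + h) - u (s, y)\<close> and then to
  \<open>t \<mapsto> a (s, t)\<close>.\<close>

lemma second_difference_mean_value:
  fixes u :: "real \<times> real \<Rightarrow> real"
  assumes "0 < h"
    and u: "\<And>q. q \<in> {x..x + h} \<times> {y..y + h} \<Longrightarrow> (u has_derivative (\<lambda>k. a q * fst k + b q * snd k)) (at q)"
    and a: "\<And>q. q \<in> {x..x + h} \<times> {y..y + h} \<Longrightarrow> (a has_derivative (\<lambda>k. ax q * fst k + ay q * snd k)) (at q)"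
  obtains q where "q \<in> {x..x + h} \<times> {y..y + h}"
    "u (x + h, y + h) - u (x + h, y) - u (x, y + h) + u (x, y) = h * h * ay q"
proof -
  have hor: "((\<lambda>s. u (s, t)) has_real_derivative a (s, t)) (at s)"
    if "s \<in> {x..x + h}" "t \<in> {y..y + h}" for s t
  proof -
    have "((\<lambda>s. (s, t)) has_derivative (\<lambda>k. (k, 0))) (at s)" by (auto intro!: derivative_eq_intros)
    from has_derivative_compose[OF this u[of "(s, t)"]] that
    show ?thesis by (simp add: has_field_derivative_def)
  qed
  have ver: "((\<lambda>t. a (s, t)) has_real_derivative ay (s, t)) (at t)"
    if "s \<in> {x..x + h}" "t \<in> {y..y + h}" for s t
  proof -
    have "((\<lambda>t. (s, t)) has_derivative (\<lambda>k. (0, k))) (at t)" by (auto intro!: derivative_eq_intros)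
    from has_derivative_compose[OF this a[of "(s, t)"]] that
    show ?thesis by (simp add: has_field_derivative_def)
  qed
  have "\<exists>s>x. s < x + h \<and> (u (x + h, y + h) - u (x + h, y)) - (u (x, y + h) - u (x, y))
      = (x + h - x) * (a (s, y + h) - a (s, y))"
    by (rule MVT2[where f = "\<lambda>s. u (s, y + h) - u (s, y)"])
       (use \<open>0 < h\<close> in \<open>auto intro!: DERIV_diff hor\<close>)
  then obtain s where s: "x < s" "s < x + h"
    "(u (x + h, y + h) - u (x + h, y)) - (u (x, y + h) - u (x, y)) = h * (a (s, y + h) - a (s, y))"
    by auto
  have "\<exists>t>y. t < y + h \<and> a (s, y + h) - a (s, y) = (y + h - y) * ay (s, t)"
    by (rule MVT2[where f = "\<lambda>t. a (s, t)"]) (use \<open>0 < h\<close> s in \<open>auto intro!: ver\<close>)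
  then obtain t where t: "y < t" "t < y + h" "a (s, y + h) - a (s, y) = h * ay (s, t)"
    by auto
  show thesis
    by (rule that[of "(s, t)"]) (use s t in auto)
qed

text \<open>The second difference of \<open>u\<close> over a small square is symmetric in the two coordinates; evaluating
  it in both orders yields a value of \<open>ay\<close> and a value of \<open>bx\<close> at points near \<open>p\<close> that coincide.\<close>

lemma mixed_partials_eq:
  fixes u :: "real \<times> real \<Rightarrow> real"
  assumes T: "open T" "p \<in> T"
    and u: "\<And>q. q \<in> T \<Longrightarrow> (u has_derivative (\<lambda>k. a q * fst k + b q * snd k)) (at q)"
    and a: "\<And>q. q \<in> T \<Longrightarrow> (a has_derivative (\<lambda>k. ax q * fst k + ay q * snd k)) (at q)"
    and b: "\<And>q. q \<in> T \<Longrightarrow> (b has_derivative (\<lambda>k. bx q * fst k + by q * snd k)) (at q)"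
    and cont: "continuous_on T ay" "continuous_on T bx"
  shows "ay p = bx p"
proof (rule ccontr)
  assume "ay p \<noteq> bx p"
  define e where "e = \<bar>ay p - bx p\<bar> / 2"
  have "e > 0" using \<open>ay p \<noteq> bx p\<close> by (simp add: e_def)
  obtain \<delta>0 where \<delta>0: "\<delta>0 > 0" "ball p \<delta>0 \<subseteq> T" using T open_contains_ball by metis
  obtain \<delta>1 where \<delta>1: "\<delta>1 > 0" "\<And>q. q \<in> T \<Longrightarrow> dist q p < \<delta>1 \<Longrightarrow> dist (ay q) (ay p) < e"
    using cont(1) T(2) \<open>e > 0\<close> unfolding continuous_on_iff by metis
  obtain \<delta>2 where \<delta>2: "\<delta>2 > 0" "\<And>q. q \<in> T \<Longrightarrow> dist q p < \<delta>2 \<Longrightarrow> dist (bx q) (bx p) < e"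
    using cont(2) T(2) \<open>e > 0\<close> unfolding continuous_on_iff by metis
  define h where "h = min \<delta>0 (min \<delta>1 \<delta>2) / 3"
  have h: "0 < h" "2 * h < \<delta>0" "2 * h < \<delta>1" "2 * h < \<delta>2"
    using \<delta>0 \<delta>1 \<delta>2 by (auto simp: h_def)
  obtain x y where p: "p = (x, y)" by (cases p)
  have near: "dist q p \<le> 2 * h" if "q \<in> {x..x + h} \<times> {y..y + h}" for q
  proof -
    have "dist q p \<le> \<bar>fst q - x\<bar> + \<bar>snd q - y\<bar>"
      using norm_Pair_le[of "fst q - x" "snd q - y"] by (simp add: dist_norm p minus_prod_def)
    also have "\<dots> \<le> h + h" using that by (intro add_mono) auto
    finally show ?thesis by simp
  qed
  have inT: "q \<in> T" if "q \<in> {x..x + h} \<times> {y..y + h}" for q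
    using near[OF that] h \<delta>0(2) by (auto simp: dist_commute)
  obtain q where q: "q \<in> {x..x + h} \<times> {y..y + h}"
    "u (x + h, y + h) - u (x + h, y) - u (x, y + h) + u (x, y) = h * h * ay q"
    by (rule second_difference_mean_value[OF h(1) u[OF inT] a[OF inT]])
  \<comment> \<open>The other order is obtained from \<open>u\<close> with its coordinates interchanged.\<close>
  let ?sw = "\<lambda>q :: real \<times> real. (snd q, fst q)"
  have sw: "(?sw has_derivative ?sw) (at q)" for q by (auto intro!: derivative_eq_intros)
  have swT: "?sw q \<in> T" if "q \<in> {y..y + h} \<times> {x..x + h}" for q
    using that by (intro inT) auto
  have swap: "((\<lambda>q. f (?sw q)) has_derivative (\<lambda>k. B * fst k + A * snd k)) (at q)"
    if "(f has_derivative (\<lambda>k. A * fst k + B * snd k)) (at (?sw q))"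
    for f :: "real \<times> real \<Rightarrow> real" and A B q
    using has_derivative_compose[OF sw that] by (simp add: add.commute)
  obtain q' where q': "q' \<in> {y..y + h} \<times> {x..x + h}"
    "u (x + h, y + h) - u (x, y + h) - u (x + h, y) + u (x, y) = h * h * bx (?sw q')"
  proof (rule second_difference_mean_value[where u = "\<lambda>q. u (?sw q)" and a = "\<lambda>q. b (?sw q)"
        and b = "\<lambda>q. a (?sw q)" and ax = "\<lambda>q. by (?sw q)" and ay = "\<lambda>q. bx (?sw q)"
        and x = y and y = x, OF h(1)])
    fix q :: "real \<times> real" assume "q \<in> {y..y + h} \<times> {x..x + h}"
    then have "?sw q \<in> T" by (rule swT)
    then show "((\<lambda>q. u (?sw q)) has_derivative (\<lambda>k. b (?sw q) * fst k + a (?sw q) * snd k)) (at q)"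
      "((\<lambda>q. b (?sw q)) has_derivative (\<lambda>k. by (?sw q) * fst k + bx (?sw q) * snd k)) (at q)"
      by (intro swap u b; assumption)+
  qed simp
  then have sw': "?sw q' \<in> {x..x + h} \<times> {y..y + h}" by auto
  have "h * h * ay q = h * h * bx (?sw q')" using q(2) q'(2) by linarith
  then have "ay q = bx (?sw q')" using h by simp
  moreover have "dist (ay q) (ay p) < e" using near[OF q(1)] inT[OF q(1)] h by (intro \<delta>1) auto
  moreover have "dist (bx (?sw q')) (bx p) < e" using near[OF sw'] inT[OF sw'] h by (intro \<delta>2) auto
  ultimately have "\<bar>ay p - bx p\<bar> < 2 * e" by (simp add: dist_real_def)
  then show False by (simp add: e_def)
qed

section \<open>Calculus on planar domains\<close>

lemma has_derivative_within_cong: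
  assumes "\<And>q. q \<in> S \<Longrightarrow> f q = g q" "p \<in> S"
  shows "(f has_derivative D) (at p within S) \<longleftrightarrow> (g has_derivative D) (at p within S)"
  using assms has_derivative_transform[of p S f g D] has_derivative_transform[of p S g f D] by auto

lemma pd_cong:
  assumes "\<And>q. q \<in> S \<Longrightarrow> f q = g q" "p \<in> S"
  shows "pdx S f p = pdx S g p" "pdy S f p = pdy S g p"
  by (simp_all add: pdx_def pdy_def frechet_derivative_def has_derivative_within_cong[OF assms])

lemma Ck_on_cong:
  "(\<And>q. q \<in> S \<Longrightarrow> f q = g q) \<Longrightarrow> Ck_on k S f \<longleftrightarrow> Ck_on k S g"
proof (induction k arbitrary: f g)
  case 0
  then show ?case by (simp cong: continuous_on_cong)
next
  case (Suc k)
  have "f differentiable_on S \<longleftrightarrow> g differentiable_on S"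
    by (simp add: differentiable_on_def differentiable_def has_derivative_within_cong[OF Suc.prems])
  moreover have "Ck_on k S (pdx S f) \<longleftrightarrow> Ck_on k S (pdx S g)" "Ck_on k S (pdy S f) \<longleftrightarrow> Ck_on k S (pdy S g)"
    by (intro Suc.IH pd_cong Suc.prems; assumption)+
  ultimately show ?case by simp
qed

lemma has_derivative_pd:
  assumes "f differentiable_on S" "p \<in> S"
  shows "(f has_derivative (\<lambda>h. pdx S f p * fst h + pdy S f p * snd h)) (at p within S)"
proof -
  have D: "(f has_derivative frechet_derivative f (at p within S)) (at p within S)"
    using assms by (simp add: differentiable_on_def frechet_derivative_works)
  then interpret linear "frechet_derivative f (at p within S)" by (rule has_derivative_linear)
  have "frechet_derivative f (at p within S) = (\<lambda>h. pdx S f p * fst h + pdy S f p * snd h)"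
  proof
    fix h :: "real \<times> real"
    have "h = fst h *\<^sub>R (1, 0) + snd h *\<^sub>R (0, 1)" by (cases h) simp
    then have "frechet_derivative f (at p within S) h
        = frechet_derivative f (at p within S) (fst h *\<^sub>R (1, 0) + snd h *\<^sub>R (0, 1))" by (rule arg_cong)
    then show "frechet_derivative f (at p within S) h = pdx S f p * fst h + pdy S f p * snd h"
      by (simp only: add scale pdx_def pdy_def real_scaleR_def mult.commute)
  qed
  with D show ?thesis by simp
qed

text \<open>This converts a derivative into the partial derivatives chosen by the definitions; it relies on
  uniqueness of derivatives, also at boundary points.\<close>

lemma pd_eqI:
  assumes S: "planar_domain S" and p: "p \<in> S"
    and D: "(f has_derivative (\<lambda>h. A * fst h + B * snd h)) (at p within S)"
  shows "pdx S f p = A" "pdy S f p = B"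
proof -
  have "(f has_derivative frechet_derivative f (at p within S)) (at p within S)"
    using D by (auto simp: differentiable_def simp flip: frechet_derivative_works)
  then have "frechet_derivative f (at p within S) = (\<lambda>h. A * fst h + B * snd h)"
    using planar_domain_derivative_unique[OF S p] D by blast
  then show "pdx S f p = A" "pdy S f p = B" by (simp_all add: pdx_def pdy_def)
qed

lemma Ck_on_SucI:
  assumes S: "planar_domain S"
    and D: "\<And>p. p \<in> S \<Longrightarrow> (f has_derivative (\<lambda>h. A p * fst h + B p * snd h)) (at p within S)"
    and AB: "Ck_on k S A" "Ck_on k S B"
  shows "Ck_on (Suc k) S f"
proof -
  have "f differentiable_on S" using D by (auto simp: differentiable_on_def differentiable_def)
  moreover have "Ck_on k S (pdx S f) \<longleftrightarrow> Ck_on k S A" "Ck_on k S (pdy S f) \<longleftrightarrow> Ck_on k S B"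
    by (intro Ck_on_cong pd_eqI[OF S _ D]; assumption)+
  ultimately show ?thesis using AB by simp
qed

lemma Ck_on_1D:
  assumes "Ck_on 1 S f"
  shows "f differentiable_on S" "continuous_on S f" "continuous_on S (pdx S f)" "continuous_on S (pdy S f)"
  using assms differentiable_imp_continuous_on by auto

lemma Ck_on_2D:
  assumes "Ck_on 2 S f"
  shows "f differentiable_on S" "Ck_on 1 S (pdx S f)" "Ck_on 1 S (pdy S f)"
  using assms by (simp_all add: numeral_2_eq_2)

lemma Ck_on_1_mult:
  assumes S: "planar_domain S" and f: "Ck_on 1 S f" and g: "Ck_on 1 S g"
  shows "Ck_on 1 S (\<lambda>p. f p * g p)"
  unfolding One_nat_def
proof (rule Ck_on_SucI[OF S])
  show "((\<lambda>p. f p * g p) has_derivative (\<lambda>h. (f p * pdx S g p + pdx S f p * g p) * fst h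
      + (f p * pdy S g p + pdy S f p * g p) * snd h)) (at p within S)" if "p \<in> S" for p
    using has_derivative_mult[OF has_derivative_pd[OF Ck_on_1D(1)[OF f] that] has_derivative_pd[OF Ck_on_1D(1)[OF g] that]]
    by (simp add: algebra_simps)
qed (use Ck_on_1D[OF f] Ck_on_1D[OF g] in \<open>auto intro!: continuous_intros\<close>)

lemma Ck_on_1_compose:
  assumes S: "planar_domain S" and f: "Ck_on 1 S f"
    and k: "\<And>p. p \<in> S \<Longrightarrow> (k has_real_derivative k' (f p)) (at (f p))"
    and k': "continuous_on S (\<lambda>p. k' (f p))"
  shows "Ck_on 1 S (\<lambda>p. k (f p))"
  unfolding One_nat_def
proof (rule Ck_on_SucI[OF S])
  show "((\<lambda>p. k (f p)) has_derivative (\<lambda>h. (k' (f p) * pdx S f p) * fst h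
      + (k' (f p) * pdy S f p) * snd h)) (at p within S)" if "p \<in> S" for p
    using has_derivative_compose[OF has_derivative_pd[OF Ck_on_1D(1)[OF f] that]
        has_field_derivative_imp_has_derivative[OF k[OF that]]]
    by (simp add: algebra_simps)
qed (use Ck_on_1D[OF f] k' in \<open>auto intro!: continuous_intros\<close>)

text \<open>Both sides are continuous on \<open>S\<close> and agree on the interior, which is dense in \<open>S\<close>.\<close>

lemma planar_domain_mixed_partials:
  assumes S: "planar_domain S" and u: "Ck_on 2 S u" and p: "p \<in> S"
  shows "pdx S (pdy S u) p = pdy S (pdx S u) p"
proof -
  note u1 = Ck_on_2D(1)[OF u] and ux = Ck_on_1D[OF Ck_on_2D(2)[OF u]] and uy = Ck_on_1D[OF Ck_on_2D(3)[OF u]]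
  have at: "q \<in> S" "at q within S = at q" if "q \<in> interior S" for q
    using that interior_subset at_within_interior by auto
  have "pdx S (pdy S u) q - pdy S (pdx S u) q = 0" if q: "q \<in> interior S" for q
  proof -
    have "pdy S (pdx S u) q = pdx S (pdy S u) q"
    proof (rule mixed_partials_eq[OF open_interior q])
      fix x assume x: "x \<in> interior S"
      show "(u has_derivative (\<lambda>k. pdx S u x * fst k + pdy S u x * snd k)) (at x)"
        "(pdx S u has_derivative (\<lambda>k. pdx S (pdx S u) x * fst k + pdy S (pdx S u) x * snd k)) (at x)"
        "(pdy S u has_derivative (\<lambda>k. pdx S (pdy S u) x * fst k + pdy S (pdy S u) x * snd k)) (at x)"
        using has_derivative_pd[OF u1 at(1)[OF x]] has_derivative_pd[OF ux(1) at(1)[OF x]]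
          has_derivative_pd[OF uy(1) at(1)[OF x]] by (simp_all only: at(2)[OF x])
    qed (use ux uy continuous_on_subset interior_subset in blast)+
    then show ?thesis by simp
  qed
  moreover have "continuous_on (closure (interior S)) (\<lambda>q. pdx S (pdy S u) q - pdy S (pdx S u) q)"
    using S ux uy by (auto simp: planar_domain_def intro!: continuous_intros)
  moreover have "p \<in> closure (interior S)" using p S by (simp add: planar_domain_def)
  ultimately have "pdx S (pdy S u) p - pdy S (pdx S u) p = 0"
    using continuous_constant_on_closure by blast
  then show ?thesis by simp
qed

lemma planar_domain_differ_by_constant:
  assumes S: "planar_domain S" and u: "u differentiable_on S" and w: "w differentiable_on S"
    and eq: "\<And>p. p \<in> S \<Longrightarrow> pdx S w p = pdx S u p" "\<And>p. p \<in> S \<Longrightarrow> pdy S w p = pdy S u p"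
  obtains c where "\<And>p. p \<in> S \<Longrightarrow> w p = u p + c"
proof -
  have clo: "S = closure (interior S)" and conn: "connected (interior S)"
    using S by (auto simp: planar_domain_def)
  obtain p0 where p0: "p0 \<in> interior S" using S by (metis closure_empty ex_in_conv planar_domain_def)
  have zero: "((\<lambda>p. w p - u p) has_derivative (\<lambda>h. 0)) (at p)" if p: "p \<in> interior S" for p
  proof -
    have pS: "p \<in> S" using p interior_subset by auto
    from has_derivative_diff[OF has_derivative_pd[OF w pS] has_derivative_pd[OF u pS]]
    show ?thesis by (simp add: eq[OF pS] at_within_interior[OF p])
  qed
  have "w p - u p = w p0 - u p0" if "p \<in> interior S" for p
    by (rule has_derivative_zero_unique_connected[OF open_interior conn zero that p0])
  moreover have "continuous_on (closure (interior S)) (\<lambda>p. w p - u p)"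
    using u w clo differentiable_imp_continuous_on by (metis continuous_on_diff)
  ultimately have "w p - u p = w p0 - u p0" if "p \<in> S" for p
    using that clo continuous_constant_on_closure[of "interior S" "\<lambda>p. w p - u p"] by blast
  then show thesis by (intro that[of "w p0 - u p0"]) (simp add: algebra_simps)
qed

text \<open>The Poincare lemma up to the boundary: a primitive exists on the simply connected interior
  and extends to \<open>S\<close>.\<close>

lemma planar_domain_closed_form_exact:
  assumes S: "planar_domain S" and f: "Ck_on 1 S f" and g: "Ck_on 1 S g"
    and closed: "\<And>p. p \<in> S \<Longrightarrow> pdy S f p = pdx S g p"
  obtains u where "Ck_on 2 S u" "\<And>p. p \<in> S \<Longrightarrow> pdx S u p = f p" "\<And>p. p \<in> S \<Longrightarrow> pdy S u p = g p"
proof -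
  note f' = Ck_on_1D[OF f] and g' = Ck_on_1D[OF g]
  have at: "q \<in> S" "at q within S = at q" if "q \<in> interior S" for q
    using that interior_subset at_within_interior by auto
  have cont: "continuous_on (interior S) k" if "continuous_on S k" for k :: "real \<times> real \<Rightarrow> real"
    using that interior_subset by (rule continuous_on_subset)
  obtain u0 where u0: "\<And>p. p \<in> interior S \<Longrightarrow> (u0 has_derivative (\<lambda>h. f p * fst h + g p * snd h)) (at p)"
  proof (rule closed_form_exact_interior[OF S])
    fix p assume p: "p \<in> interior S"
    show "(f has_derivative (\<lambda>h. pdx S f p * fst h + pdy S f p * snd h)) (at p)"
      "(g has_derivative (\<lambda>h. pdx S g p * fst h + pdy S g p * snd h)) (at p)"
      using has_derivative_pd[OF f'(1) at(1)[OF p]] has_derivative_pd[OF g'(1) at(1)[OF p]]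
      by (simp_all only: at(2)[OF p])
    show "pdy S f p = pdx S g p" using closed at(1)[OF p] .
  qed (rule cont[OF f'(3)] cont[OF f'(4)] cont[OF g'(3)] cont[OF g'(4)] | (rule that, assumption))+
  obtain u where u: "\<And>p. p \<in> S \<Longrightarrow> (u has_derivative (\<lambda>h. f p * fst h + g p * snd h)) (at p within S)"
    using planar_domain_primitive_extends[OF S u0 f'(2) g'(2)] by blast
  show thesis
  proof (rule that)
    show "Ck_on 2 S u" using Ck_on_SucI[OF S u f g] by (simp add: numeral_2_eq_2)
  qed (rule pd_eqI[OF S _ u]; assumption)+
qed

section \<open>The first order system and the second order equation\<close>

text \<open>The function differentiated by \<open>x\<close> in the second order equation. The second equation of the
  system says that it equals \<open>- 2\<close> times the \<open>y\<close>-derivative of \<open>u\<close>.\<close>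

definition flux :: "(real \<times> real) set \<Rightarrow> real \<Rightarrow> (real \<times> real \<Rightarrow> real) \<Rightarrow> real \<times> real \<Rightarrow> real" where
  "flux S a v p = ((v p)\<^sup>2 + (snd p)\<^sup>2 + a\<^sup>2) powr (- 1/2) * pdx S v p"

lemma second_order_equation_iff_flux:
  "second_order_equation S a v \<longleftrightarrow> (\<forall>p\<in>S. pdx S (flux S a v) p + 2 * pdy S (pdy S v) p = 0)"
proof -
  have "(\<lambda>(x, y). ((v (x, y))\<^sup>2 + y\<^sup>2 + a\<^sup>2) powr (- 1/2) * pdx S v (x, y)) = flux S a v"
    by (auto simp: flux_def)
  then show ?thesis unfolding second_order_equation_def by auto
qed

lemma first_order_system_iff_flux:
  assumes "a \<noteq> 0"
  shows "first_order_system S a u v \<longleftrightarrow>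
    (\<forall>p\<in>S. pdx S u p = pdy S v p \<and> pdy S u p = - (1/2) * flux S a v p)"
proof -
  have solve: "X = - 2 * w powr (1/2) * Y \<longleftrightarrow> Y = - (1/2) * (w powr (- 1/2) * X)" if "w > 0" for w X Y :: real
  proof -
    have "w powr (1/2) * w powr (- 1/2) = 1" using that by (simp flip: powr_add)
    then have "w powr (- 1/2) * (w powr (1/2) * Y) = Y" "w powr (1/2) * (w powr (- 1/2) * X) = X"
      by (simp_all add: mult.left_commute flip: mult.assoc)
    then show ?thesis by auto
  qed
  have pos: "0 < (v p)\<^sup>2 + (snd p)\<^sup>2 + a\<^sup>2" for p
    using assms by (simp add: add_nonneg_pos)
  have "first_order_system S a u v \<longleftrightarrow> (\<forall>p\<in>S. pdx S u p = pdy S v p \<and>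
      pdx S v p = - 2 * ((v p)\<^sup>2 + (snd p)\<^sup>2 + a\<^sup>2) powr (1/2) * pdy S u p)"
    unfolding first_order_system_def by auto
  then show ?thesis unfolding flux_def by (simp only: solve[OF pos])
qed

lemma Ck_on_1_flux:
  assumes S: "planar_domain S" and v: "Ck_on 2 S v" and "a \<noteq> 0"
  shows "Ck_on 1 S (flux S a v)"
proof -
  define W where "W p = (v p)\<^sup>2 + (snd p)\<^sup>2 + a\<^sup>2" for p
  have pos: "0 < W p" for p using \<open>a \<noteq> 0\<close> by (simp add: W_def add_nonneg_pos)
  note v1 = Ck_on_2D(1)[OF v] and vx = Ck_on_2D(2)[OF v] and vy = Ck_on_2D(3)[OF v]
  have contv: "continuous_on S v" using v1 by (rule differentiable_imp_continuous_on)
  have "Ck_on (Suc 0) S W"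
  proof (rule Ck_on_SucI[OF S])
    show "(W has_derivative (\<lambda>h. 2 * v p * pdx S v p * fst h + (2 * v p * pdy S v p + 2 * snd p) * snd h)) (at p within S)"
      if "p \<in> S" for p
      unfolding W_def[abs_def] using has_derivative_pd[OF v1 that]
      by (auto intro!: derivative_eq_intros simp: algebra_simps)
  qed (use contv Ck_on_1D[OF vx] Ck_on_1D[OF vy] in \<open>auto intro!: continuous_intros\<close>)
  then have W: "Ck_on 1 S W" by simp
  have "Ck_on 1 S (\<lambda>p. W p powr (- 1/2))"
  proof (rule Ck_on_1_compose[OF S W])
    show "((\<lambda>t. t powr (- 1/2)) has_real_derivative (- 1/2) * W p powr (- 1/2 - 1)) (at (W p))" for p
      using pos by (rule has_real_derivative_powr)
    show "continuous_on S (\<lambda>p. (- 1/2) * W p powr (- 1/2 - 1))"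
      using Ck_on_1D(2)[OF W] pos by (intro continuous_intros) (auto simp: less_imp_neq[symmetric])
  qed
  from Ck_on_1_mult[OF S this vx] show ?thesis
    by (simp add: flux_def[abs_def] W_def)
qed

theorem proposition8p1:
  fixes S :: "(real \<times> real) set" and a :: real
  assumes "planar_domain S" and "a \<noteq> 0"
  shows "(\<forall>u v. Ck_on 2 S u \<and> Ck_on 2 S v \<and> first_order_system S a u v
            \<longrightarrow> second_order_equation S a v) \<and>
         (\<forall>v. Ck_on 2 S v \<and> second_order_equation S a v
            \<longrightarrow> (\<exists>u. Ck_on 2 S u \<and> first_order_system S a u v \<and>
                  (\<forall>w. Ck_on 2 S w \<and> first_order_system S a w v
                     \<longleftrightarrow> (\<exists>c. \<forall>p\<in>S. w p = u p + c))))"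
proof (intro conjI allI impI; elim conjE)
  note S = assms(1)
  note system = first_order_system_iff_flux[OF assms(2)]
  fix u v assume u: "Ck_on 2 S u" and "first_order_system S a u v"
  then have eq: "pdx S u p = pdy S v p" "flux S a v p = - 2 * pdy S u p" if "p \<in> S" for p
    using that unfolding system by auto
  show "second_order_equation S a v"
    unfolding second_order_equation_iff_flux
  proof
    fix p assume p: "p \<in> S"
    have "(pdy S u has_derivative (\<lambda>h. pdx S (pdy S u) p * fst h + pdy S (pdy S u) p * snd h)) (at p within S)"
      using Ck_on_1D(1)[OF Ck_on_2D(3)[OF u]] p by (rule has_derivative_pd)
    from has_derivative_mult_right[OF this, of "- 2"]
    have "((\<lambda>q. - 2 * pdy S u q) has_derivative
        (\<lambda>h. (- 2 * pdx S (pdy S u) p) * fst h + (- 2 * pdy S (pdy S u) p) * snd h)) (at p within S)"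
      by (simp add: algebra_simps)
    then have "pdx S (\<lambda>q. - 2 * pdy S u q) p = - 2 * pdx S (pdy S u) p"
      by (rule pd_eqI(1)[OF S p])
    moreover have "pdx S (flux S a v) p = pdx S (\<lambda>q. - 2 * pdy S u q) p"
      using eq(2) p by (rule pd_cong)
    moreover have "pdy S (pdy S v) p = pdy S (pdx S u) p"
      using eq(1) p by (intro pd_cong) auto
    ultimately show "pdx S (flux S a v) p + 2 * pdy S (pdy S v) p = 0"
      using planar_domain_mixed_partials[OF S u p] by simp
  qed
next
  note S = assms(1)
  note system = first_order_system_iff_flux[OF assms(2)]
  fix v assume v: "Ck_on 2 S v" and "second_order_equation S a v"
  then have eq: "pdx S (flux S a v) p + 2 * pdy S (pdy S v) p = 0" if "p \<in> S" for p
    using that unfolding second_order_equation_iff_flux by blast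
  note G = Ck_on_1_flux[OF S v assms(2)]
  define g where "g p = - (1/2) * flux S a v p" for p
  have Dg: "(g has_derivative (\<lambda>h. (- (1/2) * pdx S (flux S a v) p) * fst h
      + (- (1/2) * pdy S (flux S a v) p) * snd h)) (at p within S)" if "p \<in> S" for p
    using has_derivative_mult_right[OF has_derivative_pd[OF Ck_on_1D(1)[OF G] that], of "- (1/2)"]
    by (simp add: g_def[abs_def] algebra_simps)
  have "Ck_on (Suc 0) S g"
    by (rule Ck_on_SucI[OF S Dg]) (use Ck_on_1D[OF G] in \<open>auto intro!: continuous_intros\<close>)
  then have g: "Ck_on 1 S g" by simp
  \<comment> \<open>The second order equation says that the form \<open>v\<^sub>y dx + g dy\<close> is closed.\<close>
  have "pdy S (pdy S v) p = pdx S g p" if "p \<in> S" for p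
    using eq[OF that] pd_eqI(1)[OF S that Dg[OF that]] by simp
  then obtain u where u: "Ck_on 2 S u"
    "\<And>p. p \<in> S \<Longrightarrow> pdx S u p = pdy S v p" "\<And>p. p \<in> S \<Longrightarrow> pdy S u p = g p"
    using planar_domain_closed_form_exact[OF S Ck_on_2D(3)[OF v] g] by blast
  have "Ck_on 2 S w \<and> first_order_system S a w v \<longleftrightarrow> (\<exists>c. \<forall>p\<in>S. w p = u p + c)" for w
  proof
    assume w: "Ck_on 2 S w \<and> first_order_system S a w v"
    obtain c where "\<And>p. p \<in> S \<Longrightarrow> w p = u p + c"
    proof (rule planar_domain_differ_by_constant[OF S])
      show "u differentiable_on S" "w differentiable_on S" using u(1) w Ck_on_2D(1) by blast+
      show "pdx S w p = pdx S u p" "pdy S w p = pdy S u p" if "p \<in> S" for p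
        using w that u(2,3)[OF that] unfolding system g_def by auto
    qed blast
    then show "\<exists>c. \<forall>p\<in>S. w p = u p + c" by blast
  next
    assume "\<exists>c. \<forall>p\<in>S. w p = u p + c"
    then obtain c where c: "\<And>p. p \<in> S \<Longrightarrow> u p + c = w p" by auto
    have D: "(w has_derivative (\<lambda>h. pdx S u p * fst h + pdy S u p * snd h)) (at p within S)"
      if p: "p \<in> S" for p
    proof (rule has_derivative_transform[OF p])
      show "((\<lambda>p. u p + c) has_derivative (\<lambda>h. pdx S u p * fst h + pdy S u p * snd h)) (at p within S)"
        using has_derivative_pd[OF Ck_on_2D(1)[OF u(1)] p] by (rule has_derivative_add_const)
    qed (simp add: c)
    have "Ck_on (Suc 1) S w"
      by (rule Ck_on_SucI[OF S D]) (use Ck_on_2D(2,3)[OF u(1)] in auto)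
    then have "Ck_on 2 S w" by (simp add: numeral_2_eq_2)
    moreover have "first_order_system S a w v"
      unfolding system using pd_eqI[OF S _ D] u(2,3) by (auto simp: g_def)
    ultimately show "Ck_on 2 S w \<and> first_order_system S a w v" ..
  qed
  moreover have "first_order_system S a u v" unfolding system using u by (simp add: g_def)
  ultimately show "\<exists>u. Ck_on 2 S u \<and> first_order_system S a u v \<and>
      (\<forall>w. Ck_on 2 S w \<and> first_order_system S a w v \<longleftrightarrow> (\<exists>c. \<forall>p\<in>S. w p = u p + c))"
    using u(1) by blast
qed

end
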